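(* There is a full subcategory $\mathcal{F}\subseteq\mathsf{sList}$, namely the full subcategory spanned by the fundamental simplicial lists, such that there is an equivalence of categories $\mathsf{sList}\simeq\mathsf{Set}^{\mathcal{F}^{op}}$.
   Context: For a set $X$, $\mathcal{L}X=\coprod_{n\ge 0}X^n$ is the set of finite sequences in $X$. A listing from $A$ to $X$ is a function $u:A\to\mathcal{L}X$; listings compose by concatenation: if $u(a)=(x_1,\dots,x_k)$ then $(vu)(a)=v(x_1)*\dots*v(x_k)$. $\mathsf{List}$ is the category of sets and listings; a function is viewed as a listing all of whose values have length $1$. A simplicial list is a functor $X:\Delta^{op}\to\mathsf{List}$. $\mathsf{sList}$ is the category of simplicial lists whose morphisms are the natural transformations all of whose components are functions. A listing between simplicial lists is an arbitrary natural transformation (components are listings). A listing of sets $u:A\to\mathcal{L}X$ is perfect if each $x\in X$ appears as a term of $u(a)$ for a unique $a\in A$, and for each $a\in A$ the terms of $u(a)$ are pairwise distinct. A listing of simplicial lists is perfect if each of its components is perfect. A simplicial list $U$ is fundamental if, for some $n\ge0$, there is a perfect listing $u$ from the simplicial set $\Delta^n$ (viewed as a simplicial list) to $U$ such that $u(1_{[n]})$ is a sequence of length one. Fundamental simplicial lists are considered up to isomorphism, i.e. $\mathcal{F}$ is taken to be skeletal (hence essentially small). *)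

theory Defs
  imports Main "HOL-Library.FuncSet"
begin

section \<open>Categories, functors, equivalences\<close>

text \<open>
  Hom-sets of different pairs of objects need not be disjoint, so composition and the arrow part
  of a functor take the objects involved as arguments.
\<close>

record ('o, 'm) cat =
  Ob :: "'o set"
  Hom :: "'o \<Rightarrow> 'o \<Rightarrow> 'm set"
  Id :: "'o \<Rightarrow> 'm"
  Comp :: "'o \<Rightarrow> 'o \<Rightarrow> 'o \<Rightarrow> 'm \<Rightarrow> 'm \<Rightarrow> 'm"  \<comment> \<open>\<open>Comp C a b c g f\<close> is \<open>g\<close> after \<open>f\<close>\<close>

definition category :: "('o, 'm) cat \<Rightarrow> bool" where
  "category C \<longleftrightarrow>
     (\<forall>a\<in>Ob C. Id C a \<in> Hom C a a) \<and>
     (\<forall>a\<in>Ob C. \<forall>b\<in>Ob C. \<forall>c\<in>Ob C. \<forall>f\<in>Hom C a b. \<forall>g\<in>Hom C b c.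
        Comp C a b c g f \<in> Hom C a c) \<and>
     (\<forall>a\<in>Ob C. \<forall>b\<in>Ob C. \<forall>f\<in>Hom C a b.
        Comp C a a b f (Id C a) = f \<and> Comp C a b b (Id C b) f = f) \<and>
     (\<forall>a\<in>Ob C. \<forall>b\<in>Ob C. \<forall>c\<in>Ob C. \<forall>d\<in>Ob C.
        \<forall>f\<in>Hom C a b. \<forall>g\<in>Hom C b c. \<forall>h\<in>Hom C c d.
        Comp C a c d h (Comp C a b c g f) = Comp C a b d (Comp C b c d h g) f)"

definition op_cat :: "('o, 'm) cat \<Rightarrow> ('o, 'm) cat" where
  "op_cat C = \<lparr>Ob = Ob C, Hom = (\<lambda>a b. Hom C b a), Id = Id C,
               Comp = (\<lambda>a b c g f. Comp C c b a f g)\<rparr>"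

definition full_subcat :: "('o, 'm) cat \<Rightarrow> 'o set \<Rightarrow> ('o, 'm) cat" where
  "full_subcat C S = C\<lparr>Ob := Ob C \<inter> S\<rparr>"

definition is_iso :: "('o, 'm) cat \<Rightarrow> 'o \<Rightarrow> 'o \<Rightarrow> 'm \<Rightarrow> bool" where
  "is_iso C a b f \<longleftrightarrow> f \<in> Hom C a b \<and>
     (\<exists>g\<in>Hom C b a. Comp C a b a g f = Id C a \<and> Comp C b a b f g = Id C b)"

definition isomorphic :: "('o, 'm) cat \<Rightarrow> 'o \<Rightarrow> 'o \<Rightarrow> bool" where
  "isomorphic C a b \<longleftrightarrow> (\<exists>f. is_iso C a b f)"

definition skeleton_of :: "('o, 'm) cat \<Rightarrow> 'o set \<Rightarrow> 'o set \<Rightarrow> bool" where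
  "skeleton_of C S T \<longleftrightarrow> T \<subseteq> S \<and> (\<forall>a\<in>S. \<exists>!b. b \<in> T \<and> isomorphic C a b)"

record ('o, 'm, 'p, 'n) functor_data =
  fobj :: "'o \<Rightarrow> 'p"
  farr :: "'o \<Rightarrow> 'o \<Rightarrow> 'm \<Rightarrow> 'n"

text \<open>
  Functors and natural transformations take the value \<open>undefined\<close> off their domain, so that
  HOL equality is equality of functors and of natural transformations.
\<close>

definition is_functor ::
  "('o, 'm) cat \<Rightarrow> ('p, 'n) cat \<Rightarrow> ('o, 'm, 'p, 'n) functor_data \<Rightarrow> bool" where
  "is_functor C D F \<longleftrightarrow>
     fobj F \<in> Ob C \<rightarrow>\<^sub>E Ob D \<and>
     (\<forall>a\<in>Ob C. \<forall>b\<in>Ob C. farr F a b \<in> Hom C a b \<rightarrow>\<^sub>E Hom D (fobj F a) (fobj F b)) \<and>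
     (\<forall>a b f. a \<notin> Ob C \<or> b \<notin> Ob C \<longrightarrow> farr F a b f = undefined) \<and>
     (\<forall>a\<in>Ob C. farr F a a (Id C a) = Id D (fobj F a)) \<and>
     (\<forall>a\<in>Ob C. \<forall>b\<in>Ob C. \<forall>c\<in>Ob C. \<forall>f\<in>Hom C a b. \<forall>g\<in>Hom C b c.
        farr F a c (Comp C a b c g f)
          = Comp D (fobj F a) (fobj F b) (fobj F c) (farr F b c g) (farr F a b f))"

definition nat_trans ::
  "('o, 'm) cat \<Rightarrow> ('p, 'n) cat \<Rightarrow> ('o, 'm, 'p, 'n) functor_data \<Rightarrow> ('o, 'm, 'p, 'n) functor_data
     \<Rightarrow> ('o \<Rightarrow> 'n) set" where
  "nat_trans C D F G =
     {\<eta> \<in> (\<Pi>\<^sub>E a\<in>Ob C. Hom D (fobj F a) (fobj G a)).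
        \<forall>a\<in>Ob C. \<forall>b\<in>Ob C. \<forall>f\<in>Hom C a b.
          Comp D (fobj F a) (fobj F b) (fobj G b) (\<eta> b) (farr F a b f)
            = Comp D (fobj F a) (fobj G a) (fobj G b) (farr G a b f) (\<eta> a)}"

definition functor_cat ::
  "('o, 'm) cat \<Rightarrow> ('p, 'n) cat \<Rightarrow> (('o, 'm, 'p, 'n) functor_data, 'o \<Rightarrow> 'n) cat" where
  "functor_cat C D =
     \<lparr>Ob = {F. is_functor C D F},
      Hom = nat_trans C D,
      Id = (\<lambda>F. \<lambda>a\<in>Ob C. Id D (fobj F a)),
      Comp = (\<lambda>F G H \<beta> \<alpha>. \<lambda>a\<in>Ob C. Comp D (fobj F a) (fobj G a) (fobj H a) (\<beta> a) (\<alpha> a))\<rparr>"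

definition id_functor :: "('o, 'm, 'o, 'm) functor_data" where
  "id_functor = \<lparr>fobj = (\<lambda>a. a), farr = (\<lambda>a b f. f)\<rparr>"

definition comp_functor ::
  "('p, 'n, 'q, 'k) functor_data \<Rightarrow> ('o, 'm, 'p, 'n) functor_data \<Rightarrow> ('o, 'm, 'q, 'k) functor_data" where
  "comp_functor G F =
     \<lparr>fobj = (\<lambda>a. fobj G (fobj F a)),
      farr = (\<lambda>a b f. farr G (fobj F a) (fobj F b) (farr F a b f))\<rparr>"

definition naturally_isomorphic ::
  "('o, 'm) cat \<Rightarrow> ('p, 'n) cat \<Rightarrow> ('o, 'm, 'p, 'n) functor_data \<Rightarrow> ('o, 'm, 'p, 'n) functor_data
     \<Rightarrow> bool" where
  "naturally_isomorphic C D F G \<longleftrightarrow>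
     (\<exists>\<eta>\<in>nat_trans C D F G. \<forall>a\<in>Ob C. is_iso D (fobj F a) (fobj G a) (\<eta> a))"

definition equivalent_categories :: "('o, 'm) cat \<Rightarrow> ('p, 'n) cat \<Rightarrow> bool" where
  "equivalent_categories C D \<longleftrightarrow> category C \<and> category D \<and>
     (\<exists>F G. is_functor C D F \<and> is_functor D C G \<and>
        naturally_isomorphic C C id_functor (comp_functor G F) \<and>
        naturally_isomorphic D D (comp_functor F G) id_functor)"

section \<open>Sets and listings\<close>

text \<open>
  HOL has no type of all sets. The sets of the theory are the small subsets of a type, where
  smallness satisfies the closure conditions of a Grothendieck universe that are relevant here:
  subsets, images (replacement), small unions, and a small set of the size of the continuum
  (in a Grothendieck universe, the power set of the natural numbers). A set of that size is
  needed because there can be continuum many fundamental simplicial lists up to isomorphism.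
\<close>

definition set_universe :: "('a set \<Rightarrow> bool) \<Rightarrow> bool" where
  "set_universe small \<longleftrightarrow>
     (\<forall>S T. small T \<and> S \<subseteq> T \<longrightarrow> small S) \<and>
     (\<forall>S (f :: 'a \<Rightarrow> 'a). small S \<longrightarrow> small (f ` S)) \<and>
     (\<forall>I (A :: 'a \<Rightarrow> 'a set). small I \<and> (\<forall>i\<in>I. small (A i)) \<longrightarrow> small (\<Union>i\<in>I. A i)) \<and>
     (\<exists>c :: nat set \<Rightarrow> 'a. inj c \<and> small (range c))"

lemma set_universe_all: "inj (c :: nat set \<Rightarrow> 'a) \<Longrightarrow> set_universe (\<lambda>S :: 'a set. True)"
  by (auto simp: set_universe_def)

definition SetCat :: "('a set \<Rightarrow> bool) \<Rightarrow> ('a set, 'a \<Rightarrow> 'a) cat" where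
  "SetCat small =
     \<lparr>Ob = {A. small A}, Hom = (\<lambda>A B. A \<rightarrow>\<^sub>E B), Id = (\<lambda>A. \<lambda>x\<in>A. x),
      Comp = (\<lambda>A B C g f. compose A g f)\<rparr>"

definition listings :: "'a set \<Rightarrow> 'b set \<Rightarrow> ('a \<Rightarrow> 'b list) set" where
  "listings A B = A \<rightarrow>\<^sub>E lists B"

definition lcomp :: "'a set \<Rightarrow> ('b \<Rightarrow> 'c list) \<Rightarrow> ('a \<Rightarrow> 'b list) \<Rightarrow> 'a \<Rightarrow> 'c list" where
  "lcomp A v u = (\<lambda>a\<in>A. concat (map v (u a)))"

definition ListCat :: "('a set \<Rightarrow> bool) \<Rightarrow> ('a set, 'a \<Rightarrow> 'a list) cat" where
  "ListCat small =
     \<lparr>Ob = {A. small A}, Hom = listings, Id = (\<lambda>A. \<lambda>x\<in>A. [x]),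
      Comp = (\<lambda>A B C v u. lcomp A v u)\<rparr>"

definition is_function :: "'a set \<Rightarrow> ('a \<Rightarrow> 'b list) \<Rightarrow> bool" where
  "is_function A u \<longleftrightarrow> (\<forall>a\<in>A. length (u a) = 1)"

definition perfect :: "'a set \<Rightarrow> 'b set \<Rightarrow> ('a \<Rightarrow> 'b list) \<Rightarrow> bool" where
  "perfect A X u \<longleftrightarrow> (\<forall>x\<in>X. \<exists>!a. a \<in> A \<and> x \<in> set (u a)) \<and> (\<forall>a\<in>A. distinct (u a))"

section \<open>Simplicial lists\<close>

text \<open>The object \<open>n\<close> is the ordinal \<open>[n] = {0..n}\<close>.\<close>

definition Delta :: "(nat, nat \<Rightarrow> nat) cat" where
  "Delta =
     \<lparr>Ob = UNIV, Hom = (\<lambda>m n. {f \<in> {0..m} \<rightarrow>\<^sub>E {0..n}. mono_on {0..m} f}),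
      Id = (\<lambda>n. \<lambda>i\<in>{0..n}. i), Comp = (\<lambda>k m n g f. compose {0..k} g f)\<rparr>"

type_synonym 'a sset = "(nat, nat \<Rightarrow> nat, 'a set, 'a \<Rightarrow> 'a) functor_data"
type_synonym 'a slist = "(nat, nat \<Rightarrow> nat, 'a set, 'a \<Rightarrow> 'a list) functor_data"

definition simplicial_list :: "('a set \<Rightarrow> bool) \<Rightarrow> 'a slist \<Rightarrow> bool" where
  "simplicial_list small X \<longleftrightarrow> is_functor (op_cat Delta) (ListCat small) X"

text \<open>
  Natural transformations between functors to \<open>List\<close>. This repeats \<^const>\<open>nat_trans\<close> (see the lemma
  below) with two element types, because the simplices of \<open>\<Delta>\<^sup>n\<close> have type \<^typ>\<open>nat \<Rightarrow> nat\<close>.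
  For \<open>f : [m] \<rightarrow> [n]\<close>, the induced listing from \<open>X\<^sub>n\<close> to \<open>X\<^sub>m\<close> is \<open>farr X n m f\<close>.
\<close>

definition slistings :: "'a slist \<Rightarrow> 'b slist \<Rightarrow> (nat \<Rightarrow> 'a \<Rightarrow> 'b list) set" where
  "slistings X Y =
     {\<eta>. (\<forall>n. \<eta> n \<in> listings (fobj X n) (fobj Y n)) \<and>
         (\<forall>m n. \<forall>f\<in>Hom Delta m n.
            lcomp (fobj X n) (\<eta> m) (farr X n m f) = lcomp (fobj X n) (farr Y n m f) (\<eta> n))}"

lemma slistings_eq_nat_trans:
  "slistings X Y = nat_trans (op_cat Delta) (ListCat small) X Y"
  by (auto simp: slistings_def nat_trans_def op_cat_def Delta_def ListCat_def PiE_def Pi_def)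

definition sListCat :: "('a set \<Rightarrow> bool) \<Rightarrow> ('a slist, nat \<Rightarrow> 'a \<Rightarrow> 'a list) cat" where
  "sListCat small =
     (functor_cat (op_cat Delta) (ListCat small))
       \<lparr>Hom := (\<lambda>X Y. {\<eta> \<in> slistings X Y. \<forall>n. is_function (fobj X n) (\<eta> n)})\<rparr>"

definition std_simplex :: "nat \<Rightarrow> (nat \<Rightarrow> nat) sset" where
  "std_simplex n =
     \<lparr>fobj = (\<lambda>k. Hom Delta k n),
      farr = (\<lambda>k m. \<lambda>f\<in>Hom Delta m k. \<lambda>\<theta>\<in>Hom Delta k n. Comp Delta m k n \<theta> f)\<rparr>"

definition slist_of_sset :: "'a sset \<Rightarrow> 'a slist" where
  "slist_of_sset X =
     \<lparr>fobj = fobj X,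
      farr = (\<lambda>n m. \<lambda>f\<in>Hom Delta m n. \<lambda>x\<in>fobj X n. [farr X n m f x])\<rparr>"

definition fundamental :: "'a slist \<Rightarrow> bool" where
  "fundamental U \<longleftrightarrow>
     (\<exists>n. \<exists>u\<in>slistings (slist_of_sset (std_simplex n)) U.
        (\<forall>m. perfect (fobj (std_simplex n) m) (fobj U m) (u m)) \<and>
        length (u n (Id Delta n)) = 1)"

definition fundamental_objects :: "('a set \<Rightarrow> bool) \<Rightarrow> 'a slist set" where
  "fundamental_objects small = {U. simplicial_list small U \<and> fundamental U}"

end

theory Submission
  imports Defs "HOL-Library.Countable"
begin

text \<open>
  A simplex \<open>x \<in> X\<^sub>n\<close> is the same as a listing \<open>\<Delta>\<^sup>n \<rightarrow> X\<close> whose value at \<open>1\<^bsub>[n]\<^esub>\<close> is \<open>[x]\<close>, and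
  every such listing factors, essentially uniquely, as a perfect listing \<open>\<Delta>\<^sup>n \<rightarrow> U\<close> followed by a
  map \<open>U \<rightarrow> X\<close>: the simplices of \<open>U\<close> are the positions in the lists \<open>\<theta>\<^sup>* x\<close>. A fundamental \<open>U\<close> has a
  unique generator, so a map out of \<open>U\<close> is determined by the image of the generator, and \<open>X\<^sub>n\<close> is
  the disjoint union of the sets \<open>Hom(U, X)\<close> over the \<open>U \<in> \<F>\<close> generated in degree \<open>n\<close>. Hence
  \<open>X \<mapsto> Hom(-, X)\<close> is fully faithful, and the same formula builds a simplicial list from a presheaf.
\<close>

section \<open>Generalities on categories\<close>

text \<open>Two facts carry the argument. First, \<open>Delta\<close> has no isomorphisms but
  identities, so a generator is unique and an object of \<open>\<F>\<close> has only the identity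
  automorphism; hence the simplices of \<open>X\<close> form a plain disjoint union, with no
  quotient to take. Second, lists of lists agree as soon as their concatenations and their block
  lengths agree. The laws of a generated simplicial list are known after concatenation, where they
  concern a composite \<open>\<theta> f\<close> applied to the generator, so that only block lengths
  remain to be compared. Hence the block lengths already classify simplices. A typing obstacle
  shapes the encodings: fundamental simplicial lists, the sets \<open>Hom(U, X)\<close> and disjoint
  unions must all consist of elements of \<open>'a\<close> and be small. Positions are coded through
  the injection \<open>c\<close>, a map out of \<open>U\<close> is replaced by the image of the
  generator, and a disjoint union uses a pairing on \<open>'a\<close> with the tag
  \<open>c (code U)\<close>. A code is a set of naturals, so the summands are indexed by part of the
  small set \<open>range c\<close>; this is where a small set of the size of the continuum
  enters.\<close>

lemma cat_id: "category C \<Longrightarrow> a \<in> Ob C \<Longrightarrow> Id C a \<in> Hom C a a"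
  by (simp add: category_def)

lemma cat_comp:
  "category C \<Longrightarrow> a \<in> Ob C \<Longrightarrow> b \<in> Ob C \<Longrightarrow> c \<in> Ob C \<Longrightarrow> f \<in> Hom C a b \<Longrightarrow> g \<in> Hom C b c
    \<Longrightarrow> Comp C a b c g f \<in> Hom C a c"
  by (simp add: category_def)

lemma cat_right:
  "category C \<Longrightarrow> a \<in> Ob C \<Longrightarrow> b \<in> Ob C \<Longrightarrow> f \<in> Hom C a b \<Longrightarrow> Comp C a a b f (Id C a) = f"
  by (simp add: category_def)

lemma cat_left:
  "category C \<Longrightarrow> a \<in> Ob C \<Longrightarrow> b \<in> Ob C \<Longrightarrow> f \<in> Hom C a b \<Longrightarrow> Comp C a b b (Id C b) f = f"
  by (simp add: category_def)

lemma cat_assoc: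
  "category C \<Longrightarrow> a \<in> Ob C \<Longrightarrow> b \<in> Ob C \<Longrightarrow> c \<in> Ob C \<Longrightarrow> d \<in> Ob C \<Longrightarrow>
    f \<in> Hom C a b \<Longrightarrow> g \<in> Hom C b c \<Longrightarrow> h \<in> Hom C c d \<Longrightarrow>
    Comp C a c d h (Comp C a b c g f) = Comp C a b d (Comp C b c d h g) f"
  by (simp add: category_def)

lemma categoryI:
  assumes "\<And>a. a \<in> Ob C \<Longrightarrow> Id C a \<in> Hom C a a"
    and "\<And>a b c f g. \<lbrakk>a \<in> Ob C; b \<in> Ob C; c \<in> Ob C; f \<in> Hom C a b; g \<in> Hom C b c\<rbrakk>
      \<Longrightarrow> Comp C a b c g f \<in> Hom C a c"
    and "\<And>a b f. \<lbrakk>a \<in> Ob C; b \<in> Ob C; f \<in> Hom C a b\<rbrakk> \<Longrightarrow> Comp C a a b f (Id C a) = f"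
    and "\<And>a b f. \<lbrakk>a \<in> Ob C; b \<in> Ob C; f \<in> Hom C a b\<rbrakk> \<Longrightarrow> Comp C a b b (Id C b) f = f"
    and "\<And>a b c d f g h. \<lbrakk>a \<in> Ob C; b \<in> Ob C; c \<in> Ob C; d \<in> Ob C;
        f \<in> Hom C a b; g \<in> Hom C b c; h \<in> Hom C c d\<rbrakk>
      \<Longrightarrow> Comp C a c d h (Comp C a b c g f) = Comp C a b d (Comp C b c d h g) f"
  shows "category C"
  unfolding category_def by (intro conjI ballI) (simp_all add: assms)

lemma category_SetCat: "category (SetCat small)"
  unfolding SetCat_def
  by (rule categoryI)
    (auto simp: PiE_def compose_def Pi_def extensional_def restrict_def intro!: ext)

lemma category_Delta: "category Delta"
  unfolding Delta_def
  by (rule categoryI)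
    (auto simp: PiE_def compose_def Pi_def extensional_def restrict_def mono_on_def intro!: ext)

section \<open>Functors and natural transformations\<close>

lemma functor_obj: "is_functor C D F \<Longrightarrow> a \<in> Ob C \<Longrightarrow> fobj F a \<in> Ob D"
  by (auto simp: is_functor_def)

lemma functor_arr:
  "is_functor C D F \<Longrightarrow> a \<in> Ob C \<Longrightarrow> b \<in> Ob C \<Longrightarrow> f \<in> Hom C a b
    \<Longrightarrow> farr F a b f \<in> Hom D (fobj F a) (fobj F b)"
  by (auto simp: is_functor_def)

lemma functor_id: "is_functor C D F \<Longrightarrow> a \<in> Ob C \<Longrightarrow> farr F a a (Id C a) = Id D (fobj F a)"
  by (simp add: is_functor_def)

lemma functor_comp:
  "is_functor C D F \<Longrightarrow> a \<in> Ob C \<Longrightarrow> b \<in> Ob C \<Longrightarrow> c \<in> Ob C \<Longrightarrow> f \<in> Hom C a b \<Longrightarrow> g \<in> Hom C b c \<Longrightarrow>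
    farr F a c (Comp C a b c g f)
      = Comp D (fobj F a) (fobj F b) (fobj F c) (farr F b c g) (farr F a b f)"
  by (simp add: is_functor_def)

lemma functorI:
  assumes "\<And>a. a \<in> Ob C \<Longrightarrow> fobj F a \<in> Ob D"
    and "\<And>a. a \<notin> Ob C \<Longrightarrow> fobj F a = undefined"
    and "\<And>a b f. \<lbrakk>a \<in> Ob C; b \<in> Ob C; f \<in> Hom C a b\<rbrakk>
      \<Longrightarrow> farr F a b f \<in> Hom D (fobj F a) (fobj F b)"
    and "\<And>a b f. \<lbrakk>a \<in> Ob C; b \<in> Ob C; f \<notin> Hom C a b\<rbrakk> \<Longrightarrow> farr F a b f = undefined"
    and "\<And>a b f. a \<notin> Ob C \<or> b \<notin> Ob C \<Longrightarrow> farr F a b f = undefined"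
    and "\<And>a. a \<in> Ob C \<Longrightarrow> farr F a a (Id C a) = Id D (fobj F a)"
    and "\<And>a b c f g. \<lbrakk>a \<in> Ob C; b \<in> Ob C; c \<in> Ob C; f \<in> Hom C a b; g \<in> Hom C b c\<rbrakk>
      \<Longrightarrow> farr F a c (Comp C a b c g f)
        = Comp D (fobj F a) (fobj F b) (fobj F c) (farr F b c g) (farr F a b f)"
  shows "is_functor C D F"
  unfolding is_functor_def by (intro conjI ballI allI impI PiE_I) (use assms in blast)+

lemma nat_trans_arr: "\<eta> \<in> nat_trans C D F G \<Longrightarrow> a \<in> Ob C \<Longrightarrow> \<eta> a \<in> Hom D (fobj F a) (fobj G a)"
  by (auto simp: nat_trans_def)

lemma nat_trans_natural:
  "\<eta> \<in> nat_trans C D F G \<Longrightarrow> a \<in> Ob C \<Longrightarrow> b \<in> Ob C \<Longrightarrow> f \<in> Hom C a b \<Longrightarrow>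
    Comp D (fobj F a) (fobj F b) (fobj G b) (\<eta> b) (farr F a b f)
      = Comp D (fobj F a) (fobj G a) (fobj G b) (farr G a b f) (\<eta> a)"
  by (auto simp: nat_trans_def)

lemma nat_trans_ext:
  assumes "\<eta> \<in> nat_trans C D F G" "\<theta> \<in> nat_trans C D F G" "\<And>a. a \<in> Ob C \<Longrightarrow> \<eta> a = \<theta> a"
  shows "\<eta> = \<theta>"
  using assms by (auto simp: nat_trans_def intro: PiE_ext)

lemma nat_trans_comp:
  assumes C: "category D" and F: "is_functor C D F" "is_functor C D G" "is_functor C D H"
    and \<alpha>: "\<alpha> \<in> nat_trans C D F G" and \<beta>: "\<beta> \<in> nat_trans C D G H"
  shows "(\<lambda>a\<in>Ob C. Comp D (fobj F a) (fobj G a) (fobj H a) (\<beta> a) (\<alpha> a)) \<in> nat_trans C D F H"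
proof -
  have "Comp D (fobj F a) (fobj F b) (fobj H b)
          (Comp D (fobj F b) (fobj G b) (fobj H b) (\<beta> b) (\<alpha> b)) (farr F a b f)
      = Comp D (fobj F a) (fobj H a) (fobj H b) (farr H a b f)
          (Comp D (fobj F a) (fobj G a) (fobj H a) (\<beta> a) (\<alpha> a))"
    if ab: "a \<in> Ob C" "b \<in> Ob C" and f: "f \<in> Hom C a b" for a b f
  proof -
    note obs = functor_obj[OF F(1) ab(1)] functor_obj[OF F(1) ab(2)]
      functor_obj[OF F(2) ab(1)] functor_obj[OF F(2) ab(2)]
      functor_obj[OF F(3) ab(1)] functor_obj[OF F(3) ab(2)]
    note arrs = functor_arr[OF F(1) ab f] functor_arr[OF F(2) ab f] functor_arr[OF F(3) ab f]
      nat_trans_arr[OF \<alpha> ab(1)] nat_trans_arr[OF \<alpha> ab(2)]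
      nat_trans_arr[OF \<beta> ab(1)] nat_trans_arr[OF \<beta> ab(2)]
    show ?thesis
      using cat_assoc[OF C obs(1,2,4,6) arrs(1,5,7)] cat_assoc[OF C obs(1,3,4,6) arrs(4,2,7)]
        cat_assoc[OF C obs(1,3,5,6) arrs(4,6,3)]
        nat_trans_natural[OF \<alpha> ab f] nat_trans_natural[OF \<beta> ab f] by simp
  qed
  then show ?thesis
    using cat_comp[OF C] functor_obj[OF F(1)] functor_obj[OF F(2)] functor_obj[OF F(3)]
      nat_trans_arr[OF \<alpha>] nat_trans_arr[OF \<beta>]
    by (auto simp: nat_trans_def)
qed

lemma category_functor_cat:
  assumes D: "category D"
  shows "category (functor_cat C D)"
proof (rule categoryI)
  fix F assume "F \<in> Ob (functor_cat C D)"
  then have F: "is_functor C D F" by (simp add: functor_cat_def)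
  then show "Id (functor_cat C D) F \<in> Hom (functor_cat C D) F F"
    using cat_right[OF D] cat_left[OF D] cat_id[OF D] functor_obj[OF F] functor_arr[OF F]
    by (auto simp: functor_cat_def nat_trans_def)
next
  fix F G \<eta> assume a: "F \<in> Ob (functor_cat C D)" "G \<in> Ob (functor_cat C D)"
    "\<eta> \<in> Hom (functor_cat C D) F G"
  then have F: "is_functor C D F" and G: "is_functor C D G" and \<eta>: "\<eta> \<in> nat_trans C D F G"
    by (auto simp: functor_cat_def)
  have e: "\<eta> \<in> extensional (Ob C)" using \<eta> by (simp add: nat_trans_def PiE_def)
  show "Comp (functor_cat C D) F F G \<eta> (Id (functor_cat C D) F) = \<eta>"
    using cat_right[OF D] functor_obj[OF F] functor_obj[OF G] nat_trans_arr[OF \<eta>]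
    by (intro extensionalityI[OF _ e]) (auto simp: functor_cat_def)
  show "Comp (functor_cat C D) F G G (Id (functor_cat C D) G) \<eta> = \<eta>"
    using cat_left[OF D] functor_obj[OF F] functor_obj[OF G] nat_trans_arr[OF \<eta>]
    by (intro extensionalityI[OF _ e]) (auto simp: functor_cat_def)
next
  fix F G H \<alpha> \<beta> assume "F \<in> Ob (functor_cat C D)" "G \<in> Ob (functor_cat C D)"
    "H \<in> Ob (functor_cat C D)" "\<alpha> \<in> Hom (functor_cat C D) F G" "\<beta> \<in> Hom (functor_cat C D) G H"
  then show "Comp (functor_cat C D) F G H \<beta> \<alpha> \<in> Hom (functor_cat C D) F H"
    using nat_trans_comp[OF D] by (auto simp: functor_cat_def)
next
  fix F G H K \<alpha> \<beta> \<gamma> assume "F \<in> Ob (functor_cat C D)" "G \<in> Ob (functor_cat C D)"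
    "H \<in> Ob (functor_cat C D)" "K \<in> Ob (functor_cat C D)" "\<alpha> \<in> Hom (functor_cat C D) F G"
    "\<beta> \<in> Hom (functor_cat C D) G H" "\<gamma> \<in> Hom (functor_cat C D) H K"
  then show "Comp (functor_cat C D) F H K \<gamma> (Comp (functor_cat C D) F G H \<beta> \<alpha>) =
      Comp (functor_cat C D) F G K (Comp (functor_cat C D) G H K \<gamma> \<beta>) \<alpha>"
    using cat_assoc[OF D] by (auto simp: functor_cat_def nat_trans_arr functor_obj)
qed

lemma is_iso_SetCat:
  assumes "f \<in> A \<rightarrow>\<^sub>E B" "bij_betw f A B"
  shows "is_iso (SetCat small) A B f"
  unfolding is_iso_def
proof (intro conjI bexI[of _ "\<lambda>y\<in>B. inv_into A f y"])
  show "f \<in> Hom (SetCat small) A B" using assms by (simp add: SetCat_def)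
  show "(\<lambda>y\<in>B. inv_into A f y) \<in> Hom (SetCat small) B A"
    using assms by (auto simp: SetCat_def bij_betw_def inv_into_into)
  show "Comp (SetCat small) A B A (\<lambda>y\<in>B. inv_into A f y) f = Id (SetCat small) A"
    using assms by (auto simp: SetCat_def compose_def fun_eq_iff bij_betw_def restrict_def)
  show "Comp (SetCat small) B A B f (\<lambda>y\<in>B. inv_into A f y) = Id (SetCat small) B"
    using assms by (auto simp: SetCat_def compose_def fun_eq_iff bij_betw_def restrict_def f_inv_into_f)
qed

text \<open>Objectwise inverses \<open>\<iota> a\<close>, chosen freely, are automatically natural:
  insert the identity \<open>\<eta> a\<close> after \<open>\<iota> a\<close>, move
  \<open>\<eta>\<close> across its naturality square and cancel it against
  \<open>\<iota> b\<close>.\<close>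

lemma is_iso_functor_cat:
  assumes D: "category D" and F: "is_functor C D F" and G: "is_functor C D G"
    and \<eta>: "\<eta> \<in> nat_trans C D F G"
    and iso: "\<And>a. a \<in> Ob C \<Longrightarrow> is_iso D (fobj F a) (fobj G a) (\<eta> a)"
  shows "is_iso (functor_cat C D) F G \<eta>"
proof -
  have "\<forall>a\<in>Ob C. \<exists>g. g \<in> Hom D (fobj G a) (fobj F a) \<and>
      Comp D (fobj F a) (fobj G a) (fobj F a) g (\<eta> a) = Id D (fobj F a) \<and>
      Comp D (fobj G a) (fobj F a) (fobj G a) (\<eta> a) g = Id D (fobj G a)"
    using iso unfolding is_iso_def by blast
  then obtain \<iota> where \<iota>: "\<And>a. a \<in> Ob C \<Longrightarrow> \<iota> a \<in> Hom D (fobj G a) (fobj F a)"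
      "\<And>a. a \<in> Ob C \<Longrightarrow> Comp D (fobj F a) (fobj G a) (fobj F a) (\<iota> a) (\<eta> a) = Id D (fobj F a)"
      "\<And>a. a \<in> Ob C \<Longrightarrow> Comp D (fobj G a) (fobj F a) (fobj G a) (\<eta> a) (\<iota> a) = Id D (fobj G a)"
    by metis
  have "Comp D (fobj G a) (fobj G b) (fobj F b) (\<iota> b) (farr G a b f)
      = Comp D (fobj G a) (fobj F a) (fobj F b) (farr F a b f) (\<iota> a)"
    if ab: "a \<in> Ob C" "b \<in> Ob C" and f: "f \<in> Hom C a b" for a b f
  proof -
    note obs = functor_obj[OF F ab(1)] functor_obj[OF F ab(2)]
      functor_obj[OF G ab(1)] functor_obj[OF G ab(2)]
    note arrs = functor_arr[OF F ab f] functor_arr[OF G ab f]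
      nat_trans_arr[OF \<eta> ab(1)] nat_trans_arr[OF \<eta> ab(2)]
    have "Comp D (fobj G a) (fobj G b) (fobj F b) (\<iota> b) (farr G a b f)
        = Comp D (fobj G a) (fobj G b) (fobj F b) (\<iota> b)
            (Comp D (fobj G a) (fobj G a) (fobj G b) (farr G a b f)
              (Comp D (fobj G a) (fobj F a) (fobj G a) (\<eta> a) (\<iota> a)))"
      using cat_right[OF D obs(3,4) arrs(2)] \<iota>(3)[OF ab(1)] by simp
    also have "\<dots> = Comp D (fobj G a) (fobj G b) (fobj F b) (\<iota> b)
            (Comp D (fobj G a) (fobj F a) (fobj G b)
              (Comp D (fobj F a) (fobj F b) (fobj G b) (\<eta> b) (farr F a b f)) (\<iota> a))"
      using cat_assoc[OF D obs(3,1,3,4) \<iota>(1)[OF ab(1)] arrs(3,2)] nat_trans_natural[OF \<eta> ab f]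
      by simp
    also have "\<dots> = Comp D (fobj G a) (fobj G b) (fobj F b) (\<iota> b)
            (Comp D (fobj G a) (fobj F b) (fobj G b) (\<eta> b)
              (Comp D (fobj G a) (fobj F a) (fobj F b) (farr F a b f) (\<iota> a)))"
      using cat_assoc[OF D obs(3,1,2,4) \<iota>(1)[OF ab(1)] arrs(1,4)] by simp
    also have "\<dots> = Comp D (fobj G a) (fobj F a) (fobj F b) (farr F a b f) (\<iota> a)"
      using cat_assoc[OF D obs(3,2,4,2) _ arrs(4) \<iota>(1)[OF ab(2)]]
        cat_comp[OF D obs(3,1,2) \<iota>(1)[OF ab(1)] arrs(1)]
        cat_left[OF D obs(3,2)] \<iota>(2)[OF ab(2)] by simp
    finally show ?thesis .
  qed
  then have "restrict \<iota> (Ob C) \<in> nat_trans C D G F"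
    using \<iota>(1) by (auto simp: nat_trans_def)
  then show ?thesis
    unfolding is_iso_def using \<eta> \<iota>(2,3)
    by (intro conjI bexI[of _ "restrict \<iota> (Ob C)"]) (auto simp: functor_cat_def intro!: restrict_ext)
qed

section \<open>Isomorphism classes and skeletons\<close>

lemma isomorphic_refl: "category C \<Longrightarrow> a \<in> Ob C \<Longrightarrow> isomorphic C a a"
  unfolding isomorphic_def is_iso_def by (meson cat_id cat_right)

lemma isomorphic_sym: "isomorphic C a b \<Longrightarrow> isomorphic C b a"
  unfolding isomorphic_def is_iso_def by blast

lemma is_iso_comp:
  assumes C: "category C" and ob: "a \<in> Ob C" "b \<in> Ob C" "c \<in> Ob C"
    and f: "is_iso C a b f" and g: "is_iso C b c g"
  shows "is_iso C a c (Comp C a b c g f)"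
proof -
  obtain f' g' where i: "f \<in> Hom C a b" "g \<in> Hom C b c" "f' \<in> Hom C b a" "g' \<in> Hom C c b"
      "Comp C a b a f' f = Id C a" "Comp C b a b f f' = Id C b"
      "Comp C b c b g' g = Id C b" "Comp C c b c g g' = Id C c"
    using f g unfolding is_iso_def by blast
  have "Comp C a c a (Comp C c b a f' g') (Comp C a b c g f)
      = Comp C a b a f' (Comp C a c b g' (Comp C a b c g f))"
    using cat_assoc[OF C] cat_comp[OF C] ob i by metis
  also have "\<dots> = Comp C a b a f' (Comp C a b b (Comp C b c b g' g) f)"
    using cat_assoc[OF C] ob i by metis
  finally have 1: "Comp C a c a (Comp C c b a f' g') (Comp C a b c g f) = Id C a"
    using cat_left[OF C] ob i by simp
  have "Comp C c a c (Comp C a b c g f) (Comp C c b a f' g')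
      = Comp C c b c g (Comp C c a b f (Comp C c b a f' g'))"
    using cat_assoc[OF C] cat_comp[OF C] ob i by metis
  also have "\<dots> = Comp C c b c g (Comp C c b b (Comp C b a b f f') g')"
    using cat_assoc[OF C] ob i by metis
  finally have 2: "Comp C c a c (Comp C a b c g f) (Comp C c b a f' g') = Id C c"
    using cat_left[OF C] ob i by simp
  show ?thesis
    unfolding is_iso_def using 1 2 i cat_comp[OF C] ob by blast
qed

lemma isomorphic_trans:
  assumes "category C" "a \<in> Ob C" "b \<in> Ob C" "c \<in> Ob C" "isomorphic C a b" "isomorphic C b c"
  shows "isomorphic C a c"
  using assms is_iso_comp unfolding isomorphic_def by metis

text \<open>Isomorphic objects define equivalent predicates on \<open>S\<close>, so the choice
  operator returns the same representative for both, and the image of \<open>r\<close> meets each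
  class exactly once.\<close>

lemma skeleton_exists:
  assumes C: "category C" and S: "S \<subseteq> Ob C"
  shows "\<exists>T. skeleton_of C S T"
proof -
  define r where "r a = (SOME b. b \<in> S \<and> isomorphic C a b)" for a
  have r: "r a \<in> S" "isomorphic C a (r a)" if "a \<in> S" for a
    using someI[of "\<lambda>b. b \<in> S \<and> isomorphic C a b" a] isomorphic_refl[OF C] that S
    unfolding r_def by blast+
  have rr: "r a = r b" if "a \<in> S" "b \<in> S" "isomorphic C a b" for a b
  proof -
    have "isomorphic C a x \<longleftrightarrow> isomorphic C b x" if "x \<in> S" for x
      using isomorphic_trans[OF C, of a b x] isomorphic_trans[OF C, of b a x]
        isomorphic_sym[OF \<open>isomorphic C a b\<close>] \<open>a \<in> S\<close> \<open>b \<in> S\<close> \<open>isomorphic C a b\<close> that S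
      by auto
    then show ?thesis unfolding r_def by (metis (no_types, lifting))
  qed
  have "skeleton_of C S (r ` S)"
    unfolding skeleton_of_def
  proof (intro conjI ballI)
    show "r ` S \<subseteq> S" using r by auto
    fix a assume a: "a \<in> S"
    show "\<exists>!b. b \<in> r ` S \<and> isomorphic C a b"
    proof (rule ex1I[of _ "r a"])
      show "r a \<in> r ` S \<and> isomorphic C a (r a)" using r a by auto
      fix b assume b: "b \<in> r ` S \<and> isomorphic C a b"
      then obtain c where c: "c \<in> S" "b = r c" by auto
      then have "isomorphic C a c"
        using isomorphic_trans[OF C, of a b c] isomorphic_sym[OF r(2)[of c]] r a b S by auto
      then show "b = r a" using rr[of a c] a c by simp
    qed
  qed
  then show ?thesis by blast
qed

text \<open>The quasi-inverse is built by choice: \<open>g d\<close> is an object whose image is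
  isomorphic to \<open>d\<close> by \<open>e d\<close> and \<open>e' d\<close>, and an arrow goes to
  the unique preimage of its conjugate by these isomorphisms.\<close>

lemma equivalence_of_fully_faithful:
  assumes C: "category C" and D: "category D" and F: "is_functor C D F"
    and ff: "\<And>a b. a \<in> Ob C \<Longrightarrow> b \<in> Ob C \<Longrightarrow>
      bij_betw (farr F a b) (Hom C a b) (Hom D (fobj F a) (fobj F b))"
    and es: "\<And>d. d \<in> Ob D \<Longrightarrow> \<exists>a\<in>Ob C. isomorphic D (fobj F a) d"
  shows "equivalent_categories C D"
proof -
  define lft where "lft a b = inv_into (Hom C a b) (farr F a b)" for a b
  have lft: "lft a b k \<in> Hom C a b" "farr F a b (lft a b k) = k"
    if "a \<in> Ob C" "b \<in> Ob C" "k \<in> Hom D (fobj F a) (fobj F b)" for a b k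
    using bij_betw_inv_into_right[OF ff[OF that(1,2)] that(3)]
      bij_betw_apply[OF bij_betw_inv_into[OF ff[OF that(1,2)]] that(3)] by (auto simp: lft_def)
  have inj: "f = g" if "a \<in> Ob C" "b \<in> Ob C" "f \<in> Hom C a b" "g \<in> Hom C a b"
    "farr F a b f = farr F a b g" for a b f g
    using ff[OF that(1,2)] that(3-5) by (auto simp: bij_betw_def inj_on_def)
  have "\<forall>d\<in>Ob D. \<exists>a e e'. a \<in> Ob C \<and> e \<in> Hom D (fobj F a) d \<and> e' \<in> Hom D d (fobj F a) \<and>
      Comp D (fobj F a) d (fobj F a) e' e = Id D (fobj F a) \<and> Comp D d (fobj F a) d e e' = Id D d"
    using es unfolding isomorphic_def is_iso_def by meson
  then obtain g e e' where g: "\<And>d. d \<in> Ob D \<Longrightarrow> g d \<in> Ob C"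
    and e: "\<And>d. d \<in> Ob D \<Longrightarrow> e d \<in> Hom D (fobj F (g d)) d"
    and e': "\<And>d. d \<in> Ob D \<Longrightarrow> e' d \<in> Hom D d (fobj F (g d))"
    and e'e: "\<And>d. d \<in> Ob D \<Longrightarrow> Comp D (fobj F (g d)) d (fobj F (g d)) (e' d) (e d) = Id D (fobj F (g d))"
    and ee': "\<And>d. d \<in> Ob D \<Longrightarrow> Comp D d (fobj F (g d)) d (e d) (e' d) = Id D d"
    by metis
  \<comment> \<open>The conjugate of \<open>k\<close>; its lift along the full functor
    \<open>F\<close> is the arrow part of \<open>G\<close>.\<close>
  define t where "t c d k = Comp D (fobj F (g c)) d (fobj F (g d)) (e' d)
      (Comp D (fobj F (g c)) c d k (e c))" for c d k
  define G where "G = \<lparr>fobj = restrict g (Ob D), farr = (\<lambda>c d k.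
      if c \<in> Ob D \<and> d \<in> Ob D \<and> k \<in> Hom D c d then lft (g c) (g d) (t c d k) else undefined)\<rparr>"
  have Fg: "fobj F (g d) \<in> Ob D" if "d \<in> Ob D" for d
    using functor_obj[OF F g[OF that]] .
  have t: "t c d k \<in> Hom D (fobj F (g c)) (fobj F (g d))"
    if "c \<in> Ob D" "d \<in> Ob D" "k \<in> Hom D c d" for c d k
    unfolding t_def using that e e' Fg cat_comp[OF D] by meson
  have e_t: "Comp D (fobj F (g c)) (fobj F (g d)) d (e d) (t c d k) = Comp D (fobj F (g c)) c d k (e c)"
    if "c \<in> Ob D" "d \<in> Ob D" "k \<in> Hom D c d" for c d k
  proof -
    have m: "Comp D (fobj F (g c)) c d k (e c) \<in> Hom D (fobj F (g c)) d"
      using cat_comp[OF D Fg _ _ e] that by simp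
    show ?thesis
      unfolding t_def cat_assoc[OF D Fg[OF that(1)] that(2) Fg[OF that(2)] that(2) m e'[OF that(2)] e[OF that(2)]]
      using ee' cat_left[OF D Fg _ m] that by simp
  qed
  \<comment> \<open>\<open>e d\<close> is split monic, so equations can be tested after composing
    with it; there \<open>e_t\<close> makes the conjugates telescope.\<close>
  have cancel: "k = k'" if "a \<in> Ob D" "d \<in> Ob D" "k \<in> Hom D a (fobj F (g d))" "k' \<in> Hom D a (fobj F (g d))"
    "Comp D a (fobj F (g d)) d (e d) k = Comp D a (fobj F (g d)) d (e d) k'" for a d k k'
  proof -
    have "Comp D a d (fobj F (g d)) (e' d) (Comp D a (fobj F (g d)) d (e d) k) = k"
      if "k \<in> Hom D a (fobj F (g d))" for k
      using cat_assoc[OF D _ Fg _ Fg that e e'] e'e cat_left[OF D _ Fg that] \<open>a \<in> Ob D\<close> \<open>d \<in> Ob D\<close>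
      by simp
    then show ?thesis using that by metis
  qed
  have G: "is_functor D C G"
  proof (rule functorI)
    fix a assume a: "a \<in> Ob D"
    have "t a a (Id D a) = Id D (fobj F (g a))"
      unfolding t_def using cat_left[OF D Fg a e] e'e a by simp
    then have "lft (g a) (g a) (t a a (Id D a)) = Id C (g a)"
      using lft[OF g g, of a a "t a a (Id D a)"] t[of a a "Id D a"] cat_id[OF D a] a
        functor_id[OF F g[OF a]] inj[OF g[OF a] g[OF a] _ cat_id[OF C g[OF a]]] by simp
    then show "farr G a a (Id D a) = Id C (fobj G a)"
      using a cat_id[OF D a] by (simp add: G_def)
  next
    fix a b c f h assume ob: "a \<in> Ob D" "b \<in> Ob D" "c \<in> Ob D" and f: "f \<in> Hom D a b" and h: "h \<in> Hom D b c"
    have hf: "Comp D a b c h f \<in> Hom D a c" using cat_comp[OF D ob f h] .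
    note obs = ob Fg[OF ob(1)] Fg[OF ob(2)] Fg[OF ob(3)]
    note tt = t[OF ob(1,2) f] t[OF ob(2,3) h] t[OF ob(1,3) hf]
    have "t a c (Comp D a b c h f)
        = Comp D (fobj F (g a)) (fobj F (g b)) (fobj F (g c)) (t b c h) (t a b f)"
    proof (rule cancel[OF obs(4) ob(3) tt(3) cat_comp[OF D obs(4-6) tt(1,2)]])
      have "Comp D (fobj F (g a)) (fobj F (g c)) c (e c)
          (Comp D (fobj F (g a)) (fobj F (g b)) (fobj F (g c)) (t b c h) (t a b f))
          = Comp D (fobj F (g a)) (fobj F (g b)) c (Comp D (fobj F (g b)) b c h (e b)) (t a b f)"
        using cat_assoc[OF D obs(4-6) ob(3) tt(1,2) e[OF ob(3)]] e_t[OF ob(2,3) h] by simp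
      also have "\<dots> = Comp D (fobj F (g a)) b c h (Comp D (fobj F (g a)) a b f (e a))"
        using cat_assoc[OF D obs(4,5,2,3) tt(1) e[OF ob(2)] h] e_t[OF ob(1,2) f] by simp
      also have "\<dots> = Comp D (fobj F (g a)) a c (Comp D a b c h f) (e a)"
        using cat_assoc[OF D obs(4,1,2,3) e[OF ob(1)] f h] .
      finally show "Comp D (fobj F (g a)) (fobj F (g c)) c (e c) (t a c (Comp D a b c h f)) =
          Comp D (fobj F (g a)) (fobj F (g c)) c (e c)
          (Comp D (fobj F (g a)) (fobj F (g b)) (fobj F (g c)) (t b c h) (t a b f))"
        using e_t[OF ob(1,3) hf] by simp
    qed
    then have "lft (g a) (g c) (t a c (Comp D a b c h f))
        = Comp C (g a) (g b) (g c) (lft (g b) (g c) (t b c h)) (lft (g a) (g b) (t a b f))"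
      using lft[OF g[OF ob(1)] g[OF ob(2)] tt(1)] lft[OF g[OF ob(2)] g[OF ob(3)] tt(2)]
        lft[OF g[OF ob(1)] g[OF ob(3)] tt(3)] functor_comp[OF F g[OF ob(1)] g[OF ob(2)] g[OF ob(3)]]
        cat_comp[OF C g[OF ob(1)] g[OF ob(2)] g[OF ob(3)]]
      by (intro inj[OF g[OF ob(1)] g[OF ob(3)]]) auto
    then show "farr G a c (Comp D a b c h f) =
        Comp C (fobj G a) (fobj G b) (fobj G c) (farr G b c h) (farr G a b f)"
      using ob f h hf by (simp add: G_def)
  qed (use g lft t in \<open>auto simp: G_def\<close>)
  have FG: "farr F (fobj G c) (fobj G d) (farr G c d k) = t c d k"
    if "c \<in> Ob D" "d \<in> Ob D" "k \<in> Hom D c d" for c d k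
    using that lft g t by (simp add: G_def)
  have "restrict e (Ob D) \<in> nat_trans D D (comp_functor F G) id_functor"
    using e e_t FG by (auto simp: nat_trans_def comp_functor_def id_functor_def) (auto simp: G_def)
  moreover have "is_iso D (fobj (comp_functor F G) d) (fobj id_functor d) (restrict e (Ob D) d)"
    if "d \<in> Ob D" for d
    using that e e' e'e ee'
    by (auto simp: is_iso_def comp_functor_def id_functor_def G_def intro!: bexI[of _ "e' d"])
  ultimately have 1: "naturally_isomorphic D D (comp_functor F G) id_functor"
    unfolding naturally_isomorphic_def by blast
  \<comment> \<open>The unit at \<open>a\<close> and its inverse are the lifts of \<open>e'\<close>
    and \<open>e\<close> at the image of \<open>a\<close>; their equations hold after
    \<open>F\<close> and are reflected by faithfulness.\<close>
  define u where "u a = lft a (g (fobj F a)) (e' (fobj F a))" for a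
  define u' where "u' a = lft (g (fobj F a)) a (e (fobj F a))" for a
  note Fo = functor_obj[OF F]
  have u: "u a \<in> Hom C a (g (fobj F a))" "farr F a (g (fobj F a)) (u a) = e' (fobj F a)"
    if a: "a \<in> Ob C" for a
    unfolding u_def using lft[OF _ g, of a "fobj F a"] a e' Fo by auto
  have u': "u' a \<in> Hom C (g (fobj F a)) a" "farr F (g (fobj F a)) a (u' a) = e (fobj F a)"
    if a: "a \<in> Ob C" for a
    unfolding u'_def using lft[OF g, of "fobj F a" a] a e Fo by auto
  have uu: "Comp C a (g (fobj F a)) a (u' a) (u a) = Id C a"
    "Comp C (g (fobj F a)) a (g (fobj F a)) (u a) (u' a) = Id C (g (fobj F a))"
    if a: "a \<in> Ob C" for a
  proof -
    note ga = g[OF Fo[OF a]]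
    show "Comp C a (g (fobj F a)) a (u' a) (u a) = Id C a"
      using functor_comp[OF F a ga a u(1)[OF a] u'(1)[OF a]] cat_comp[OF C a ga a u(1)[OF a] u'(1)[OF a]]
        ee'[OF Fo[OF a]] u u' a cat_id[OF C] functor_id[OF F] by (intro inj[OF a a]) auto
    show "Comp C (g (fobj F a)) a (g (fobj F a)) (u a) (u' a) = Id C (g (fobj F a))"
      using functor_comp[OF F ga a ga u'(1)[OF a] u(1)[OF a]] cat_comp[OF C ga a ga u'(1)[OF a] u(1)[OF a]]
        e'e[OF Fo[OF a]] u u' a cat_id[OF C] functor_id[OF F] ga by (intro inj[OF ga ga]) auto
  qed
  have nat: "Comp C a b (g (fobj F b)) (u b) f = Comp C a (g (fobj F a)) (g (fobj F b))
      (farr G (fobj F a) (fobj F b) (farr F a b f)) (u a)"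
    if ab: "a \<in> Ob C" "b \<in> Ob C" and f: "f \<in> Hom C a b" for a b f
  proof -
    note obF = Fo[OF ab(1)] Fo[OF ab(2)]
    note go = g[OF obF(1)] g[OF obF(2)]
    note Ff = functor_arr[OF F ab f]
    have Gf: "farr G (fobj F a) (fobj F b) (farr F a b f) \<in> Hom C (g (fobj F a)) (g (fobj F b))"
      using functor_arr[OF G obF Ff] obF by (simp add: G_def)
    have FGf: "farr F (g (fobj F a)) (g (fobj F b)) (farr G (fobj F a) (fobj F b) (farr F a b f))
        = t (fobj F a) (fobj F b) (farr F a b f)"
      using FG[OF obF Ff] obF by (simp add: G_def)
    show ?thesis
    proof (rule inj[OF ab(1) go(2) cat_comp[OF C ab go(2) f u(1)[OF ab(2)]]
          cat_comp[OF C ab(1) go u(1)[OF ab(1)] Gf]])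
      have "Comp D (fobj F a) (fobj F (g (fobj F a))) (fobj F (g (fobj F b)))
          (t (fobj F a) (fobj F b) (farr F a b f)) (e' (fobj F a))
        = Comp D (fobj F a) (fobj F b) (fobj F (g (fobj F b))) (e' (fobj F b)) (farr F a b f)"
      proof (rule cancel[OF obF(1,2) cat_comp[OF D obF(1) Fg[OF obF(1)] Fg[OF obF(2)] e'[OF obF(1)] t[OF obF Ff]]
            cat_comp[OF D obF Fg[OF obF(2)] Ff e'[OF obF(2)]]])
        show "Comp D (fobj F a) (fobj F (g (fobj F b))) (fobj F b) (e (fobj F b))
          (Comp D (fobj F a) (fobj F (g (fobj F a))) (fobj F (g (fobj F b)))
            (t (fobj F a) (fobj F b) (farr F a b f)) (e' (fobj F a))) =
          Comp D (fobj F a) (fobj F (g (fobj F b))) (fobj F b) (e (fobj F b))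
          (Comp D (fobj F a) (fobj F b) (fobj F (g (fobj F b))) (e' (fobj F b)) (farr F a b f))"
          using cat_assoc[OF D obF(1) Fg[OF obF(1)] Fg[OF obF(2)] obF(2) e'[OF obF(1)] t[OF obF Ff] e[OF obF(2)]]
            cat_assoc[OF D obF(1) Fg[OF obF(1)] obF e'[OF obF(1)] e[OF obF(1)] Ff]
            cat_assoc[OF D obF Fg[OF obF(2)] obF(2) Ff e'[OF obF(2)] e[OF obF(2)]]
            ee'[OF obF(1)] ee'[OF obF(2)] cat_left[OF D obF Ff] cat_right[OF D obF Ff] e_t[OF obF Ff] by simp
      qed
      then show "farr F a (g (fobj F b)) (Comp C a b (g (fobj F b)) (u b) f) =
        farr F a (g (fobj F b)) (Comp C a (g (fobj F a)) (g (fobj F b))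
          (farr G (fobj F a) (fobj F b) (farr F a b f)) (u a))"
        using functor_comp[OF F ab go(2) f u(1)[OF ab(2)]]
          functor_comp[OF F ab(1) go u(1)[OF ab(1)] Gf] u(2)[OF ab(1)] u(2)[OF ab(2)] FGf by simp
    qed
  qed
  have "restrict u (Ob C) \<in> nat_trans C C id_functor (comp_functor G F)"
    using nat u(1) Fo by (auto simp: nat_trans_def comp_functor_def id_functor_def) (auto simp: G_def)
  moreover have "is_iso C (fobj id_functor a) (fobj (comp_functor G F) a) (restrict u (Ob C) a)"
    if "a \<in> Ob C" for a
    using that u u' uu Fo
    by (auto simp: is_iso_def comp_functor_def id_functor_def G_def intro!: bexI[of _ "u' a"])
  ultimately have 2: "naturally_isomorphic C C id_functor (comp_functor G F)"
    unfolding naturally_isomorphic_def by blast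
  show ?thesis
    unfolding equivalent_categories_def using C D F G 1 2 by blast
qed

lemma op_cat_simps [simp]:
  "Ob (op_cat C) = Ob C" "Hom (op_cat C) a b = Hom C b a" "Id (op_cat C) = Id C"
  "Comp (op_cat C) a b c g f = Comp C c b a f g"
  by (simp_all add: op_cat_def)

lemma SetCat_simps [simp]:
  "Ob (SetCat small) = {A. small A}" "Hom (SetCat small) A B = A \<rightarrow>\<^sub>E B"
  "Id (SetCat small) A = (\<lambda>x\<in>A. x)" "Comp (SetCat small) A B C g f = compose A g f"
  by (simp_all add: SetCat_def)

lemma full_subcat_simps [simp]:
  "Ob (full_subcat C S) = Ob C \<inter> S" "Hom (full_subcat C S) = Hom C" "Id (full_subcat C S) = Id C"
  "Comp (full_subcat C S) = Comp C"
  by (simp_all add: full_subcat_def)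

lemma functor_cat_simps [simp]:
  "Ob (functor_cat C D) = {F. is_functor C D F}" "Hom (functor_cat C D) = nat_trans C D"
  "Id (functor_cat C D) F = (\<lambda>a\<in>Ob C. Id D (fobj F a))"
  "Comp (functor_cat C D) F G H \<beta> \<alpha> =
    (\<lambda>a\<in>Ob C. Comp D (fobj F a) (fobj G a) (fobj H a) (\<beta> a) (\<alpha> a))"
  by (simp_all add: functor_cat_def)

section \<open>Simplicial lists\<close>

lemma ListCat_simps [simp]:
  "Ob (ListCat small) = {A. small A}" "Hom (ListCat small) = listings"
  "Id (ListCat small) A = (\<lambda>x\<in>A. [x])" "Comp (ListCat small) A B C v u = lcomp A v u"
  by (simp_all add: ListCat_def)

lemma Ob_Delta [simp]: "Ob Delta = UNIV"
  by (simp add: Delta_def)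

lemma Delta_hom_iff: "f \<in> Hom Delta m n \<longleftrightarrow> f \<in> {0..m} \<rightarrow>\<^sub>E {0..n} \<and> mono_on {0..m} f"
  by (simp add: Delta_def)

lemma Delta_comp [simp, intro]:
  "f \<in> Hom Delta m n \<Longrightarrow> g \<in> Hom Delta k m \<Longrightarrow> Comp Delta k m n f g \<in> Hom Delta k n"
  using cat_comp[OF category_Delta] by (simp add: Delta_def)

lemma Delta_id [simp, intro]: "Id Delta n \<in> Hom Delta n n"
  by (rule cat_id[OF category_Delta]) (simp add: Delta_def)

lemma Delta_id_comp [simp]: "f \<in> Hom Delta m n \<Longrightarrow> Comp Delta m n n (Id Delta n) f = f"
  by (rule cat_left[OF category_Delta]) (simp_all add: Delta_def)

lemma Delta_comp_id [simp]: "f \<in> Hom Delta m n \<Longrightarrow> Comp Delta m m n f (Id Delta m) = f"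
  by (rule cat_right[OF category_Delta]) (simp_all add: Delta_def)

lemma Delta_assoc:
  "f \<in> Hom Delta m n \<Longrightarrow> g \<in> Hom Delta k m \<Longrightarrow> h \<in> Hom Delta l k \<Longrightarrow>
    Comp Delta l m n f (Comp Delta l k m g h) = Comp Delta l k n (Comp Delta k m n f g) h"
  using cat_assoc[OF category_Delta, of l k m n h g f] by (simp add: Delta_def)

lemma mono_inj_ge_id:
  fixes \<theta> :: "nat \<Rightarrow> nat"
  assumes "mono_on {0..n} \<theta>" "inj_on \<theta> {0..n}" "i \<le> n"
  shows "i \<le> \<theta> i"
  using \<open>i \<le> n\<close>
proof (induction i)
  case (Suc i)
  have "\<theta> i \<le> \<theta> (Suc i)" using assms(1) Suc.prems by (auto simp: mono_on_def)
  moreover have "\<theta> i \<noteq> \<theta> (Suc i)" using inj_onD[OF assms(2), of i "Suc i"] Suc.prems by auto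
  ultimately show ?case using Suc by auto
qed simp

text \<open>Both maps are monotone and injective, so \<open>i \<le> f i\<close> and
  \<open>f i \<le> g (f i) = i\<close>; likewise \<open>m \<le> f m \<le> n\<close> and
  symmetrically.\<close>

lemma Delta_inverse_imp_id:
  assumes f: "f \<in> Hom Delta m n" and g: "g \<in> Hom Delta n m"
    and fg: "Comp Delta n m n f g = Id Delta n" and gf: "Comp Delta m n m g f = Id Delta m"
  shows "m = n \<and> f = Id Delta n"
proof -
  have gf': "g (f i) = i" if "i \<le> m" for i
    using fun_cong[OF gf, of i] that by (simp add: Delta_def compose_def)
  have fg': "f (g i) = i" if "i \<le> n" for i
    using fun_cong[OF fg, of i] that by (simp add: Delta_def compose_def)
  have fm: "mono_on {0..m} f" and gm: "mono_on {0..n} g"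
    using f g by (simp_all add: Delta_hom_iff)
  have fi: "f i \<le> n" if "i \<le> m" for i
    using f g that by (auto simp: Delta_hom_iff PiE_def Pi_def)
  have gi: "g i \<le> m" if "i \<le> n" for i
    using g that by (auto simp: Delta_hom_iff PiE_def Pi_def)
  have f1: "i \<le> f i" if "i \<le> m" for i
    using mono_inj_ge_id[OF fm inj_on_inverseI[of _ g] that] gf' by simp
  have g1: "i \<le> g i" if "i \<le> n" for i
    using mono_inj_ge_id[OF gm inj_on_inverseI[of _ f] that] fg' by simp
  have "f i = i" if "i \<le> m" for i
    using f1[OF that] g1[OF fi[OF that]] gf'[OF that] by simp
  moreover have "m = n"
    using f1[of m] fi[of m] g1[of n] gi[of n] by simp
  ultimately have "f i = Id Delta n i" for i
    using f by (auto simp: Delta_hom_iff PiE_def extensional_def) (auto simp: Delta_def)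
  then show ?thesis using \<open>m = n\<close> by auto
qed

text \<open>The functor laws on actual simplices, stripped of smallness and of the
  \<open>undefined\<close> conventions, so that calculations stay elementwise.
  \<open>simplicial_list_iff\<close> adds the stripped conditions back.\<close>

definition slist :: "'a slist \<Rightarrow> bool" where
  "slist X \<longleftrightarrow>
     (\<forall>m n. \<forall>f\<in>Hom Delta m n. \<forall>x\<in>fobj X n. set (farr X n m f x) \<subseteq> fobj X m) \<and>
     (\<forall>n. \<forall>x\<in>fobj X n. farr X n n (Id Delta n) x = [x]) \<and>
     (\<forall>k m n. \<forall>f\<in>Hom Delta m n. \<forall>g\<in>Hom Delta k m. \<forall>x\<in>fobj X n.
        farr X n k (Comp Delta k m n f g) x = concat (map (farr X m k g) (farr X n m f x)))"

lemma slist_in: "slist X \<Longrightarrow> f \<in> Hom Delta m n \<Longrightarrow> x \<in> fobj X n \<Longrightarrow> set (farr X n m f x) \<subseteq> fobj X m"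
  by (simp add: slist_def)

lemma slist_id: "slist X \<Longrightarrow> x \<in> fobj X n \<Longrightarrow> farr X n n (Id Delta n) x = [x]"
  by (simp add: slist_def)

lemma slist_comp:
  "slist X \<Longrightarrow> f \<in> Hom Delta m n \<Longrightarrow> g \<in> Hom Delta k m \<Longrightarrow> x \<in> fobj X n \<Longrightarrow>
    farr X n k (Comp Delta k m n f g) x = concat (map (farr X m k g) (farr X n m f x))"
  by (simp add: slist_def)

lemma simplicial_list_iff:
  "simplicial_list small X \<longleftrightarrow> slist X \<and> (\<forall>n. small (fobj X n)) \<and>
     (\<forall>n m f. f \<notin> Hom Delta m n \<longrightarrow> farr X n m f = undefined) \<and>
     (\<forall>n m. \<forall>f\<in>Hom Delta m n. farr X n m f \<in> extensional (fobj X n))"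
  (is "_ \<longleftrightarrow> ?R")
proof
  assume "simplicial_list small X"
  then have F: "is_functor (op_cat Delta) (ListCat small) X" by (simp add: simplicial_list_def)
  have arr: "farr X n m f \<in> listings (fobj X n) (fobj X m)" if "f \<in> Hom Delta m n" for n m f
    using functor_arr[OF F, of n m f] that by simp
  have id: "farr X n n (Id Delta n) = (\<lambda>x\<in>fobj X n. [x])" for n
    using functor_id[OF F, of n] by simp
  have comp: "farr X n k (Comp Delta k m n f g) = lcomp (fobj X n) (farr X m k g) (farr X n m f)"
    if "f \<in> Hom Delta m n" "g \<in> Hom Delta k m" for k m n f g
    using functor_comp[OF F, of n m k f g] that by simp
  have "farr X n m f = undefined" if "f \<notin> Hom Delta m n" for n m f
    using F that by (auto simp: is_functor_def PiE_def extensional_def)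
  moreover have "small (fobj X n)" for n
    using functor_obj[OF F, of n] by simp
  moreover have "slist X"
    using arr id comp by (auto simp: slist_def listings_def PiE_def Pi_def lists_eq_set lcomp_def)
  ultimately show ?R using arr by (auto simp: listings_def PiE_def)
next
  assume R: ?R
  then have X: "slist X" by simp
  have ext: "farr X n m f \<in> extensional (fobj X n)" if "f \<in> Hom Delta m n" for n m f
    using R that by blast
  show "simplicial_list small X"
    unfolding simplicial_list_def
  proof (rule functorI)
    fix n m f assume "f \<in> Hom (op_cat Delta) n m"
    then show "farr X n m f \<in> Hom (ListCat small) (fobj X n) (fobj X m)"
      using slist_in[OF X] ext by (auto simp: listings_def PiE_def lists_eq_set)
  next
    fix n
    show "farr X n n (Id (op_cat Delta) n) = Id (ListCat small) (fobj X n)"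
      using ext[OF Delta_id] slist_id[OF X] by (intro extensionalityI[of _ "fobj X n"]) auto
  next
    fix n m k f g assume "f \<in> Hom (op_cat Delta) n m" "g \<in> Hom (op_cat Delta) m k"
    then show "farr X n k (Comp (op_cat Delta) n m k g f) =
        Comp (ListCat small) (fobj X n) (fobj X m) (fobj X k) (farr X m k g) (farr X n m f)"
      using ext[OF Delta_comp, of f m n g k] slist_comp[OF X, of f m n g k]
      by (intro extensionalityI[of _ "fobj X n"]) (auto simp: lcomp_def)
  qed (use R in auto)
qed

lemma simplicial_list_slist: "simplicial_list small X \<Longrightarrow> slist X"
  by (simp add: simplicial_list_iff)

text \<open>Truncating \<open>r\<close> off its domain makes the extensionality clauses of
  \<open>simplicial_list_iff\<close> hold by construction, so only the elementwise laws remain to be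
  proved.\<close>

definition mk_slist :: "(nat \<Rightarrow> 'a set) \<Rightarrow> (nat \<Rightarrow> nat \<Rightarrow> (nat \<Rightarrow> nat) \<Rightarrow> 'a \<Rightarrow> 'a list) \<Rightarrow> 'a slist" where
  "mk_slist A r = \<lparr>fobj = A,
     farr = (\<lambda>n m f. if f \<in> Hom Delta m n then restrict (r n m f) (A n) else undefined)\<rparr>"

lemma fobj_mk_slist [simp]: "fobj (mk_slist A r) = A"
  by (simp add: mk_slist_def)

lemma farr_mk_slist [simp]:
  "f \<in> Hom Delta m n \<Longrightarrow> x \<in> A n \<Longrightarrow> farr (mk_slist A r) n m f x = r n m f x"
  by (simp add: mk_slist_def)

lemma simplicial_list_mk_slist:
  assumes "slist (mk_slist A r)" "\<And>n. small (A n)"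
  shows "simplicial_list small (mk_slist A r)"
  using assms by (auto simp: simplicial_list_iff) (auto simp: mk_slist_def)

text \<open>Morphisms of simplicial lists as bare functions: when the components are functions,
  composition of listings reduces to \<open>map\<close>. Values off the simplices are arbitrary;
  \<open>lift\<close> normalises them.\<close>

definition smap :: "'a slist \<Rightarrow> 'b slist \<Rightarrow> (nat \<Rightarrow> 'a \<Rightarrow> 'b) \<Rightarrow> bool" where
  "smap X Y h \<longleftrightarrow> (\<forall>n. \<forall>x\<in>fobj X n. h n x \<in> fobj Y n) \<and>
     (\<forall>m n. \<forall>f\<in>Hom Delta m n. \<forall>x\<in>fobj X n. farr Y n m f (h n x) = map (h m) (farr X n m f x))"

lemma smap_in: "smap X Y h \<Longrightarrow> x \<in> fobj X n \<Longrightarrow> h n x \<in> fobj Y n"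
  by (simp add: smap_def)

lemma smap_natural:
  "smap X Y h \<Longrightarrow> f \<in> Hom Delta m n \<Longrightarrow> x \<in> fobj X n \<Longrightarrow>
    farr Y n m f (h n x) = map (h m) (farr X n m f x)"
  by (simp add: smap_def)

lemma smap_id: "smap X X (\<lambda>n x. x)"
  by (simp add: smap_def)

lemma smap_comp: "smap X Y h \<Longrightarrow> smap Y Z g \<Longrightarrow> smap X Z (\<lambda>n x. g n (h n x))"
  by (simp add: smap_def)

section \<open>Generators of fundamental simplicial lists\<close>

text \<open>By Yoneda a listing out of the standard simplex is determined by its value at the
  identity. This is perfectness of the listing that sends \<open>\<theta>\<close> to
  \<open>farr U n m \<theta> e\<close>.\<close>

definition is_gen :: "'a slist \<Rightarrow> nat \<Rightarrow> 'a \<Rightarrow> bool" where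
  "is_gen U n e \<longleftrightarrow> e \<in> fobj U n \<and>
     (\<forall>m. \<forall>v\<in>fobj U m. \<exists>!\<theta>. \<theta> \<in> Hom Delta m n \<and> v \<in> set (farr U n m \<theta> e)) \<and>
     (\<forall>m. \<forall>\<theta>\<in>Hom Delta m n. distinct (farr U n m \<theta> e))"

lemma is_gen_in: "is_gen U n e \<Longrightarrow> e \<in> fobj U n"
  by (simp add: is_gen_def)

lemma is_gen_obtain:
  assumes "is_gen U n e" "v \<in> fobj U m"
  obtains \<theta> where "\<theta> \<in> Hom Delta m n" "v \<in> set (farr U n m \<theta> e)"
  using assms by (meson is_gen_def)

lemma is_gen_unique_index:
  assumes "is_gen U n e" "v \<in> fobj U m" "\<theta> \<in> Hom Delta m n" "v \<in> set (farr U n m \<theta> e)"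
    "\<theta>' \<in> Hom Delta m n" "v \<in> set (farr U n m \<theta>' e)"
  shows "\<theta> = \<theta>'"
  using assms unfolding is_gen_def by metis

lemma is_gen_distinct: "is_gen U n e \<Longrightarrow> \<theta> \<in> Hom Delta m n \<Longrightarrow> distinct (farr U n m \<theta> e)"
  by (simp add: is_gen_def)

lemma fobj_std_simplex [simp]: "fobj (std_simplex n) k = Hom Delta k n"
  by (simp add: std_simplex_def)

lemma fobj_slist_of_sset [simp]: "fobj (slist_of_sset X) = fobj X"
  by (simp add: slist_of_sset_def)

lemma farr_slist_of_std_simplex [simp]:
  "f \<in> Hom Delta m k \<Longrightarrow> \<theta> \<in> Hom Delta k n \<Longrightarrow>
    farr (slist_of_sset (std_simplex n)) k m f \<theta> = [Comp Delta m k n \<theta> f]"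
  by (simp add: slist_of_sset_def std_simplex_def)

lemma fundamental_iff_gen:
  assumes U: "slist U"
  shows "fundamental U \<longleftrightarrow> (\<exists>n e. is_gen U n e)"
proof
  assume "fundamental U"
  then obtain n u where u: "u \<in> slistings (slist_of_sset (std_simplex n)) U"
    and p: "\<And>m. perfect (Hom Delta m n) (fobj U m) (u m)"
    and l: "length (u n (Id Delta n)) = 1"
    unfolding fundamental_def by auto
  obtain e where e: "u n (Id Delta n) = [e]"
    using l by (auto simp: length_Suc_conv)
  have ul: "u m \<in> listings (Hom Delta m n) (fobj U m)" for m
    using u by (simp add: slistings_def)
  have "set (u n (Id Delta n)) \<subseteq> fobj U n"
    using ul[of n] by (auto simp: listings_def PiE_def Pi_def lists_eq_set)
  then have eU: "e \<in> fobj U n" using e by simp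
  \<comment> \<open>The Yoneda step: naturality of \<open>u\<close> along \<open>\<theta>\<close>,
    evaluated at \<open>Id Delta n\<close>, where \<open>u\<close> has the single term
    \<open>e\<close>.\<close>
  have *: "farr U n m \<theta> e = u m \<theta>" if \<theta>: "\<theta> \<in> Hom Delta m n" for m \<theta>
  proof -
    have "lcomp (Hom Delta n n) (u m) (farr (slist_of_sset (std_simplex n)) n m \<theta>)
        = lcomp (Hom Delta n n) (farr U n m \<theta>) (u n)"
      using u \<theta> by (simp add: slistings_def)
    from fun_cong[OF this, of "Id Delta n"] show ?thesis
      using \<theta> e by (simp add: lcomp_def)
  qed
  have "is_gen U n e"
    using eU p * unfolding is_gen_def perfect_def by metis
  then show "\<exists>n e. is_gen U n e" by blast
next
  assume "\<exists>n e. is_gen U n e"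
  then obtain n e where e: "is_gen U n e" by blast
  note eU = is_gen_in[OF e]
  define u where "u m = (\<lambda>\<theta>\<in>Hom Delta m n. farr U n m \<theta> e)" for m
  have "u \<in> slistings (slist_of_sset (std_simplex n)) U"
    unfolding slistings_def
  proof (intro CollectI conjI allI ballI)
    fix m show "u m \<in> listings (fobj (slist_of_sset (std_simplex n)) m) (fobj U m)"
      using slist_in[OF U _ eU] by (auto simp: listings_def u_def lists_eq_set)
  next
    fix m k f assume f: "f \<in> Hom Delta m k"
    show "lcomp (fobj (slist_of_sset (std_simplex n)) k) (u m) (farr (slist_of_sset (std_simplex n)) k m f) =
       lcomp (fobj (slist_of_sset (std_simplex n)) k) (farr U k m f) (u k)"
      unfolding lcomp_def
      by (rule restrict_ext) (use f slist_comp[OF U _ f eU] in \<open>auto simp: u_def\<close>)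
  qed
  moreover have "perfect (Hom Delta m n) (fobj U m) (u m)" for m
    using e unfolding is_gen_def perfect_def u_def by (auto simp: Ball_def cong: conj_cong)
  moreover have "length (u n (Id Delta n)) = 1"
    using slist_id[OF U eU] by (simp add: u_def)
  ultimately show "fundamental U" unfolding fundamental_def by auto
qed

text \<open>Each generator is a term of a list obtained from the other, along
  \<open>\<theta>\<close> and \<open>\<theta>'\<close>. Going round, \<open>e\<close> is a term of
  the list of the composite and of the list of the identity; uniqueness of the index makes the
  composite an identity, on either side. In \<open>Delta\<close> this forces \<open>\<theta>\<close>
  itself to be an identity.\<close>

lemma is_gen_unique:
  assumes U: "slist U" and e: "is_gen U n e" and e': "is_gen U n' e'"
  shows "n = n' \<and> e = e'"
proof -
  note eU = is_gen_in[OF e] note eU' = is_gen_in[OF e']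
  obtain \<theta> where \<theta>: "\<theta> \<in> Hom Delta n' n" "e' \<in> set (farr U n n' \<theta> e)"
    using is_gen_obtain[OF e eU'] .
  obtain \<theta>' where \<theta>': "\<theta>' \<in> Hom Delta n n'" "e \<in> set (farr U n' n \<theta>' e')"
    using is_gen_obtain[OF e' eU] .
  have "e \<in> set (farr U n n (Comp Delta n n' n \<theta> \<theta>') e)"
    using slist_comp[OF U \<theta>(1) \<theta>'(1) eU] \<theta> \<theta>' by auto
  then have 1: "Comp Delta n n' n \<theta> \<theta>' = Id Delta n"
    using is_gen_unique_index[OF e eU] \<theta>(1) \<theta>'(1) slist_id[OF U eU]
    by (metis Delta_comp Delta_id list.set_intros(1))
  have "e' \<in> set (farr U n' n' (Comp Delta n' n n' \<theta>' \<theta>) e')"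
    using slist_comp[OF U \<theta>'(1) \<theta>(1) eU'] \<theta> \<theta>' by auto
  then have 2: "Comp Delta n' n n' \<theta>' \<theta> = Id Delta n'"
    using is_gen_unique_index[OF e' eU'] \<theta>(1) \<theta>'(1) slist_id[OF U eU']
    by (metis Delta_comp Delta_id list.set_intros(1))
  have "n' = n \<and> \<theta> = Id Delta n"
    using Delta_inverse_imp_id[OF \<theta>(1) \<theta>'(1) 1 2] .
  then show ?thesis using \<theta>(2) slist_id[OF U eU] by auto
qed

text \<open>Every simplex of \<open>U\<close> is a term of a list
  \<open>farr U n m \<theta> e\<close>, and naturality fixes the image of that list term by
  term.\<close>

lemma smap_eq_on_gen:
  assumes "is_gen U n e" "smap U X g" "smap U X h" "g n e = h n e" "v \<in> fobj U m"
  shows "g m v = h m v"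
proof -
  obtain \<theta> where \<theta>: "\<theta> \<in> Hom Delta m n" "v \<in> set (farr U n m \<theta> e)"
    using is_gen_obtain[OF assms(1,5)] .
  have "map (g m) (farr U n m \<theta> e) = map (h m) (farr U n m \<theta> e)"
    using smap_natural[OF assms(2) \<theta>(1) is_gen_in[OF assms(1)]]
      smap_natural[OF assms(3) \<theta>(1) is_gen_in[OF assms(1)]] assms(4) by simp
  then show ?thesis using \<theta>(2) by auto
qed

text \<open>Used to move a generator from a simplicial list constructed by hand to its isomorphic
  representative in a skeleton.\<close>

lemma is_gen_smap_iso:
  assumes h: "smap U V h" and g: "smap V U g"
    and gh: "\<And>n x. x \<in> fobj U n \<Longrightarrow> g n (h n x) = x" and hg: "\<And>n x. x \<in> fobj V n \<Longrightarrow> h n (g n x) = x"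
    and e: "is_gen U n e"
  shows "is_gen V n (h n e)"
  unfolding is_gen_def
proof (intro conjI allI ballI)
  note eU = is_gen_in[OF e]
  show "h n e \<in> fobj V n" using smap_in[OF h eU] .
  fix m
  have nat: "farr V n m \<theta> (h n e) = map (h m) (farr U n m \<theta> e)" if "\<theta> \<in> Hom Delta m n" for \<theta>
    using smap_natural[OF h that eU] .
  have nat': "farr U n m \<theta> e = map (g m) (farr V n m \<theta> (h n e))" if "\<theta> \<in> Hom Delta m n" for \<theta>
    using smap_natural[OF g that smap_in[OF h eU]] gh[OF eU] by simp
  fix \<theta> assume "\<theta> \<in> Hom Delta m n"
  then show "distinct (farr V n m \<theta> (h n e))"
    using nat' is_gen_distinct[OF e] by (metis distinct_map)
next
  note eU = is_gen_in[OF e]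
  fix m v assume v: "v \<in> fobj V m"
  obtain \<theta> where \<theta>: "\<theta> \<in> Hom Delta m n" "g m v \<in> set (farr U n m \<theta> e)"
    using is_gen_obtain[OF e smap_in[OF g v]] .
  show "\<exists>!\<theta>. \<theta> \<in> Hom Delta m n \<and> v \<in> set (farr V n m \<theta> (h n e))"
  proof (rule ex1I[of _ \<theta>])
    show "\<theta> \<in> Hom Delta m n \<and> v \<in> set (farr V n m \<theta> (h n e))"
      using \<theta> smap_natural[OF h \<theta>(1) eU] hg[OF v] by (auto simp: image_iff) (metis)
    fix \<theta>' assume t: "\<theta>' \<in> Hom Delta m n \<and> v \<in> set (farr V n m \<theta>' (h n e))"
    then have "g m v \<in> set (farr U n m \<theta>' e)"
      using smap_natural[OF g _ smap_in[OF h eU], of \<theta>' m] gh[OF eU] by auto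
    then show "\<theta>' = \<theta>" using is_gen_unique_index[OF e smap_in[OF g v]] \<theta> t by metis
  qed
qed

section \<open>Shapes of simplices\<close>

text \<open>The tool behind \<open>smap_of_shape\<close> and \<open>realization\<close>: identities
  there are first known for concatenated lists, and comparing lengths splits them into
  blocks.\<close>

lemma concat_eq_lengths:
  assumes "concat xss = concat yss" "map length xss = map length yss"
  shows "xss = yss"
  using assms
proof (induction xss arbitrary: yss)
  case (Cons xs xss)
  then show ?case by (cases yss) auto
qed simp

fun chop :: "nat list \<Rightarrow> 'b list \<Rightarrow> 'b list list" where
  "chop [] xs = []"
| "chop (k # ks) xs = take k xs # chop ks (drop k xs)"

lemma chop:
  "sum_list ks = length xs \<Longrightarrow> concat (chop ks xs) = xs \<and> map length (chop ks xs) = ks"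
  by (induction ks arbitrary: xs) auto

text \<open>
  The shape of \<open>x \<in> X\<^sub>n\<close> records, for all composable \<open>[k] \<rightarrow> [m] \<rightarrow> [n]\<close>, how the list
  of the composite applied to \<open>x\<close> splits into blocks. It determines the simplicial list generated
  by \<open>x\<close> up to isomorphism, and there are at most continuum many shapes.
\<close>

definition shape :: "'a slist \<Rightarrow> nat \<Rightarrow> 'a \<Rightarrow> nat set" where
  "shape X n x = {to_nat (n, m, k, map \<theta> [0..<Suc m], map f [0..<Suc k],
       map (\<lambda>v. length (farr X m k f v)) (farr X n m \<theta> x)) | m k \<theta> f.
     \<theta> \<in> Hom Delta m n \<and> f \<in> Hom Delta k m}"

text \<open>The type of functions on \<open>nat\<close> is uncountable, so shapes code a monotone
  map by its list of values. This is faithful because arrows of \<open>Delta\<close> are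
  \<open>undefined\<close> off \<open>{0..m}\<close>.\<close>

lemma Delta_code_inj:
  assumes "f \<in> Hom Delta m n" "g \<in> Hom Delta m n" "map f [0..<Suc m] = map g [0..<Suc m]"
  shows "f = g"
  using assms by (auto simp: Delta_hom_iff intro!: PiE_ext[of f "{0..m}" "\<lambda>_. {0..n}" g])

text \<open>Each entry of a shape carries its whole index, namely \<open>n\<close>,
  \<open>m\<close>, \<open>k\<close> and the codes of \<open>\<theta>\<close> and \<open>f\<close>,
  so equal sets have the same list of lengths at every index.\<close>

lemma shape_eq_iff:
  "shape X n x = shape Y n' y \<longleftrightarrow> n = n' \<and> (\<forall>m k. \<forall>\<theta>\<in>Hom Delta m n. \<forall>f\<in>Hom Delta k m.
     map (\<lambda>v. length (farr X m k f v)) (farr X n m \<theta> x)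
       = map (\<lambda>v. length (farr Y m k f v)) (farr Y n m \<theta> y))"
  (is "?L \<longleftrightarrow> ?R")
proof
  assume L: ?L
  have *: "n = n' \<and> map (\<lambda>v. length (farr X m k f v)) (farr X n m \<theta> x)
       = map (\<lambda>v. length (farr Y m k f v)) (farr Y n m \<theta> y)"
    if h: "\<theta> \<in> Hom Delta m n" "f \<in> Hom Delta k m" for m k \<theta> f
  proof -
    have "to_nat (n, m, k, map \<theta> [0..<Suc m], map f [0..<Suc k],
       map (\<lambda>v. length (farr X m k f v)) (farr X n m \<theta> x)) \<in> shape Y n' y"
      using h L unfolding shape_def by blast
    then obtain m' k' \<theta>' f' where "\<theta>' \<in> Hom Delta m' n'" "f' \<in> Hom Delta k' m'"
      and e: "(n, m, k, map \<theta> [0..<Suc m], map f [0..<Suc k],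
          map (\<lambda>v. length (farr X m k f v)) (farr X n m \<theta> x))
        = (n', m', k', map \<theta>' [0..<Suc m'], map f' [0..<Suc k'],
          map (\<lambda>v. length (farr Y m' k' f' v)) (farr Y n' m' \<theta>' y))"
      unfolding shape_def by (auto simp del: upt_Suc)
    moreover from e have e': "n = n'" "m = m'" "k = k'" "map \<theta> [0..<Suc m] = map \<theta>' [0..<Suc m]"
      "map f [0..<Suc k] = map f' [0..<Suc k]" by (auto simp del: upt_Suc)
    ultimately have "\<theta>' = \<theta>" "f' = f" using Delta_code_inj h by metis+
    then show ?thesis using e e' by blast
  qed
  \<comment> \<open>The identities supply an index, so the shapes are nonempty and
    \<open>n = n'\<close> can be read off.\<close>
  then show ?R using Delta_id by blast
next
  assume R: ?R
  then have n: "n = n'" and l: "\<And>m k \<theta> f. \<theta> \<in> Hom Delta m n \<Longrightarrow> f \<in> Hom Delta k m \<Longrightarrow>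
     map (\<lambda>v. length (farr X m k f v)) (farr X n m \<theta> x)
       = map (\<lambda>v. length (farr Y m k f v)) (farr Y n m \<theta> y)" by auto
  show ?L unfolding shape_def n[symmetric]
    by (intro Collect_cong ex_cong1 iffI) (use l in \<open>simp_all del: upt_Suc\<close>)
qed

lemma shape_eq_dim: "shape X n x = shape Y n' y \<Longrightarrow> n = n'"
  by (simp add: shape_eq_iff)

text \<open>A map acts on lists by \<open>map\<close>, which changes neither the number of blocks
  nor, by naturality at each term, their lengths.\<close>

lemma shape_smap:
  assumes "slist X" "smap X Y h" "x \<in> fobj X n"
  shows "shape Y n (h n x) = shape X n x"
  using assms slist_in[OF assms(1) _ assms(3)]
  by (auto simp: shape_eq_iff smap_natural subset_iff)

text \<open>\<open>U\<close> is free on \<open>e\<close> among simplices of its shape. A simplex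
  \<open>v\<close> of \<open>U\<close> occupies exactly one position in exactly one list
  \<open>farr U n m \<theta> e\<close>; it is sent to the term of
  \<open>farr X n m \<theta> x\<close> at that position.\<close>

lemma smap_of_shape:
  assumes U: "slist U" and e: "is_gen U n e" and X: "slist X" and x: "x \<in> fobj X n"
    and sh: "shape U n e = shape X n x"
  shows "\<exists>h. smap U X h \<and> h n e = x"
proof -
  note eU = is_gen_in[OF e]
  note sh' = sh[unfolded shape_eq_iff, THEN conjunct2, rule_format]
  \<comment> \<open>Specialised to \<open>f = Id Delta m\<close>; only the number of recorded blocks
    is used.\<close>
  have len: "length (farr U n m \<theta> e) = length (farr X n m \<theta> x)" if "\<theta> \<in> Hom Delta m n" for m \<theta>
    using arg_cong[OF sh'[OF that Delta_id], of length] by simp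
  \<comment> \<open>The value is described through every position of \<open>v\<close>, so that
    \<open>h\<close> can later be evaluated at whichever position is at hand.\<close>
  have "\<exists>y. \<forall>\<theta> i. \<theta> \<in> Hom Delta m n \<and> i < length (farr U n m \<theta> e) \<and> farr U n m \<theta> e ! i = v
      \<longrightarrow> y = farr X n m \<theta> x ! i" if v: "v \<in> fobj U m" for m v
  proof -
    obtain \<theta> where \<theta>: "\<theta> \<in> Hom Delta m n" "v \<in> set (farr U n m \<theta> e)"
      using is_gen_obtain[OF e v] .
    then obtain i where i: "i < length (farr U n m \<theta> e)" "farr U n m \<theta> e ! i = v"
      by (auto simp: in_set_conv_nth)
    show ?thesis
    proof (intro exI[of _ "farr X n m \<theta> x ! i"] allI impI)
      fix \<theta>' j assume a: "\<theta>' \<in> Hom Delta m n \<and> j < length (farr U n m \<theta>' e) \<and> farr U n m \<theta>' e ! j = v"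
      then have "\<theta> = \<theta>'" using is_gen_unique_index[OF e v \<theta>, of \<theta>'] nth_mem by blast
      then show "farr X n m \<theta> x ! i = farr X n m \<theta>' x ! j"
        using a i is_gen_distinct[OF e \<theta>(1)] nth_eq_iff_index_eq by metis
    qed
  qed
  note ex = this
  define h where "h m v = (SOME y. \<forall>\<theta> i. \<theta> \<in> Hom Delta m n \<and> i < length (farr U n m \<theta> e) \<and>
      farr U n m \<theta> e ! i = v \<longrightarrow> y = farr X n m \<theta> x ! i)" for m v
  have h: "h m v = farr X n m \<theta> x ! i" if "v \<in> fobj U m" "\<theta> \<in> Hom Delta m n"
      "i < length (farr U n m \<theta> e)" "farr U n m \<theta> e ! i = v" for m v \<theta> i
    using someI_ex[OF ex[OF that(1)]] that(2-4) unfolding h_def by blast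
  have hl: "map (h m) (farr U n m \<theta> e) = farr X n m \<theta> x" if \<theta>: "\<theta> \<in> Hom Delta m n" for m \<theta>
  proof (rule nth_equalityI)
    fix i assume i: "i < length (map (h m) (farr U n m \<theta> e))"
    then have "farr U n m \<theta> e ! i \<in> fobj U m" using slist_in[OF U \<theta> eU] nth_mem by fastforce
    then show "map (h m) (farr U n m \<theta> e) ! i = farr X n m \<theta> x ! i"
      using h[OF _ \<theta>, of _ i] i by simp
  qed (simp add: len[OF \<theta>])
  \<comment> \<open>Naturality for all terms of one list at once: both sides concatenate to the list
    of the composite at \<open>x\<close>, and equality of shapes matches the block lengths.\<close>
  have blocks: "map (\<lambda>v. map (h k) (farr U m k f v)) (farr U n m \<theta> e)
      = map (\<lambda>v. farr X m k f (h m v)) (farr U n m \<theta> e)"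
    if \<theta>: "\<theta> \<in> Hom Delta m n" and f: "f \<in> Hom Delta k m" for m k \<theta> f
  proof (rule concat_eq_lengths)
    have "concat (map (\<lambda>v. map (h k) (farr U m k f v)) (farr U n m \<theta> e))
        = map (h k) (farr U n k (Comp Delta k m n \<theta> f) e)"
      by (simp add: slist_comp[OF U \<theta> f eU] map_concat comp_def)
    also have "\<dots> = farr X n k (Comp Delta k m n \<theta> f) x" using hl \<theta> f by blast
    also have "\<dots> = concat (map (farr X m k f) (map (h m) (farr U n m \<theta> e)))"
      using slist_comp[OF X \<theta> f x] hl[OF \<theta>] by simp
    finally show "concat (map (\<lambda>v. map (h k) (farr U m k f v)) (farr U n m \<theta> e))
        = concat (map (\<lambda>v. farr X m k f (h m v)) (farr U n m \<theta> e))" by (simp add: comp_def)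
    have "map (\<lambda>v. length (farr U m k f v)) (farr U n m \<theta> e)
        = map (\<lambda>v. length (farr X m k f v)) (map (h m) (farr U n m \<theta> e))"
      using sh'[OF \<theta> f] hl[OF \<theta>] by simp
    then show "map length (map (\<lambda>v. map (h k) (farr U m k f v)) (farr U n m \<theta> e))
        = map length (map (\<lambda>v. farr X m k f (h m v)) (farr U n m \<theta> e))" by (simp add: comp_def)
  qed
  have "smap U X h"
    unfolding smap_def
  proof (intro conjI allI ballI)
    fix m v assume v: "v \<in> fobj U m"
    obtain \<theta> where \<theta>: "\<theta> \<in> Hom Delta m n" "v \<in> set (farr U n m \<theta> e)"
      using is_gen_obtain[OF e v] .
    then have "h m v \<in> set (farr X n m \<theta> x)" using hl[OF \<theta>(1)] by (metis image_eqI set_map)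
    then show "h m v \<in> fobj X m" using slist_in[OF X \<theta>(1) x] by blast
  next
    fix k m f v assume f: "f \<in> Hom Delta k m" and v: "v \<in> fobj U m"
    obtain \<theta> where \<theta>: "\<theta> \<in> Hom Delta m n" "v \<in> set (farr U n m \<theta> e)"
      using is_gen_obtain[OF e v] .
    then show "farr X m k f (h m v) = map (h k) (farr U m k f v)"
      using blocks[OF \<theta>(1) f] by (auto simp: map_eq_conv)
  qed
  moreover have "h n e = x"
    using hl[OF Delta_id] slist_id[OF U eU] slist_id[OF X x] by simp
  ultimately show ?thesis by blast
qed

lemma map_farr_mk_slist [simp]:
  "f \<in> Hom Delta m n \<Longrightarrow> set xs \<subseteq> A n \<Longrightarrow>
    map (farr (mk_slist A r) n m f) xs = map (r n m f) xs"
  by (auto simp: subset_iff)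

text \<open>The perfect factor of the listing given by \<open>x\<close>. Its simplices are positions
  because a simplex of \<open>X\<close> may occur several times in one list, or for several
  \<open>\<theta>\<close>, whereas perfectness demands distinct terms and a unique index. Smallness
  holds since all positions are coded in \<open>range c\<close>.\<close>

lemma realization:
  assumes univ: "set_universe small" and X: "slist X" and x: "x \<in> fobj X n"
  shows "\<exists>U e. simplicial_list small U \<and> is_gen U n e \<and> shape U n e = shape X n x"
proof -
  obtain c :: "nat set \<Rightarrow> 'a" where c: "inj c" "small (range c)"
    using univ by (auto simp: set_universe_def)
  text \<open>
    \<open>en m \<theta> i\<close> stands for the \<open>i\<close>-th position in the list \<open>\<theta>\<^sup>* x\<close>. The structure map \<open>r\<close> of the
    generated simplicial list cuts the positions of \<open>(\<theta> f)\<^sup>* x\<close> into blocks as \<open>X\<close> does. Its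
    functoriality holds after concatenation, and the lengths of the blocks agree.
  \<close>
  define en where "en m \<theta> i = c {to_nat (map \<theta> [0..<Suc m], i :: nat)}" for m :: nat and \<theta> :: "nat \<Rightarrow> nat" and i
  have en_inj: "\<theta> = \<theta>' \<and> i = i'" if "\<theta> \<in> Hom Delta m n" "\<theta>' \<in> Hom Delta m n" "en m \<theta> i = en m \<theta>' i'"
    for m \<theta> \<theta>' i i'
  proof -
    have "map \<theta> [0..<Suc m] = map \<theta>' [0..<Suc m] \<and> i = i'"
      using injD[OF c(1) that(3)[unfolded en_def]] by (simp del: upt_Suc)
    then show ?thesis using Delta_code_inj that(1,2) by blast
  qed
  define dec where "dec m v = (SOME p. fst p \<in> Hom Delta m n \<and> en m (fst p) (snd p) = v)" for m v
  have dec: "dec m (en m \<theta> i) = (\<theta>, i)" if "\<theta> \<in> Hom Delta m n" for m \<theta> i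
  proof -
    have "fst (dec m (en m \<theta> i)) \<in> Hom Delta m n
        \<and> en m (fst (dec m (en m \<theta> i))) (snd (dec m (en m \<theta> i))) = en m \<theta> i"
      unfolding dec_def by (rule someI[of _ "(\<theta>, i)"]) (use that in auto)
    then show ?thesis using en_inj[OF _ that] by (metis prod.collapse)
  qed
  define u where "u m \<theta> = map (en m \<theta>) [0..<length (farr X n m \<theta> x)]" for m \<theta>
  define A where "A m = (\<Union>\<theta>\<in>Hom Delta m n. set (u m \<theta>))" for m
  have AE: "\<exists>\<theta>. \<theta> \<in> Hom Delta m n \<and> v \<in> set (u m \<theta>)" if "v \<in> A m" for m v
    using that by (auto simp: A_def)
  define bl where "bl m k \<theta> f =
      chop (map (\<lambda>v. length (farr X m k f v)) (farr X n m \<theta> x)) (u k (Comp Delta k m n \<theta> f))"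
    for m k \<theta> f
  define r where "r m k f v = bl m k (fst (dec m v)) f ! snd (dec m v)" for m k f v
  \<comment> \<open>The map from \<open>U\<close> to \<open>X\<close> that reads off the simplex
    standing at a position; \<open>pi_r\<close> is its naturality.\<close>
  define \<pi> where "\<pi> m v = farr X n m (fst (dec m v)) x ! snd (dec m v)" for m v
  have pi_u: "map (\<pi> m) (u m \<theta>) = farr X n m \<theta> x" if "\<theta> \<in> Hom Delta m n" for m \<theta>
    using dec[OF that] by (auto simp: u_def \<pi>_def intro: nth_equalityI)
  have bl: "concat (bl m k \<theta> f) = u k (Comp Delta k m n \<theta> f)"
      "map length (bl m k \<theta> f) = map (\<lambda>v. length (farr X m k f v)) (farr X n m \<theta> x)"
    if "\<theta> \<in> Hom Delta m n" "f \<in> Hom Delta k m" for m k \<theta> f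
    unfolding bl_def using slist_comp[OF X that x]
    by (auto intro!: chop[THEN conjunct1] chop[THEN conjunct2] simp: u_def length_concat comp_def)
  have r_u: "map (r m k f) (u m \<theta>) = bl m k \<theta> f"
    if "\<theta> \<in> Hom Delta m n" "f \<in> Hom Delta k m" for m k \<theta> f
  proof (rule nth_equalityI)
    show "length (map (r m k f) (u m \<theta>)) = length (bl m k \<theta> f)"
      using arg_cong[OF bl(2)[OF that], of length] by (simp add: u_def)
  qed (use dec[OF that(1)] in \<open>auto simp: r_def u_def\<close>)
  have pi_r: "map (\<pi> k) (r m k f v) = farr X m k f (\<pi> m v)"
    if v: "v \<in> A m" and f: "f \<in> Hom Delta k m" for m k f v
  proof -
    obtain \<theta> where \<theta>: "\<theta> \<in> Hom Delta m n" "v \<in> set (u m \<theta>)" using AE[OF v] by blast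
    have "map (map (\<pi> k)) (map (r m k f) (u m \<theta>)) = map (farr X m k f) (map (\<pi> m) (u m \<theta>))"
    proof (rule concat_eq_lengths)
      show "concat (map (map (\<pi> k)) (map (r m k f) (u m \<theta>)))
          = concat (map (farr X m k f) (map (\<pi> m) (u m \<theta>)))"
        unfolding r_u[OF \<theta>(1) f] map_concat[symmetric] bl(1)[OF \<theta>(1) f]
        using pi_u[OF Delta_comp[OF \<theta>(1) f]] pi_u[OF \<theta>(1)] slist_comp[OF X \<theta>(1) f x] by simp
      show "map length (map (map (\<pi> k)) (map (r m k f) (u m \<theta>)))
          = map length (map (farr X m k f) (map (\<pi> m) (u m \<theta>)))"
        unfolding r_u[OF \<theta>(1) f] pi_u[OF \<theta>(1)] using bl(2)[OF \<theta>(1) f] by (simp add: comp_def)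
    qed
    then show ?thesis using \<theta>(2) by auto
  qed
  \<comment> \<open>Lengths can thus be computed in \<open>X\<close>, where the functor laws are
    given; this provides the length half of \<open>r_id\<close> and \<open>r_comp\<close>.\<close>
  have len_r: "length (r m k f v) = length (farr X m k f (\<pi> m v))"
    if v: "v \<in> A m" and f: "f \<in> Hom Delta k m" for m k f v
    using arg_cong[OF pi_r[OF that], of length] by simp
  have concat_r: "concat (map (r m k f) (u m \<theta>)) = u k (Comp Delta k m n \<theta> f)"
    if "\<theta> \<in> Hom Delta m n" "f \<in> Hom Delta k m" for m k \<theta> f
    using r_u[OF that] bl(1)[OF that] by simp
  have u_A: "set (u m \<theta>) \<subseteq> A m" if "\<theta> \<in> Hom Delta m n" for m \<theta>
    using that by (auto simp: A_def)
  have r_A: "set (r m k f v) \<subseteq> A k" if v: "v \<in> A m" and f: "f \<in> Hom Delta k m" for m k f v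
  proof -
    obtain \<theta> where \<theta>: "\<theta> \<in> Hom Delta m n" "v \<in> set (u m \<theta>)" using AE[OF v] by blast
    then have "set (r m k f v) \<subseteq> set (concat (map (r m k f) (u m \<theta>)))" by auto
    then show ?thesis using concat_r[OF \<theta>(1) f] u_A[OF Delta_comp[OF \<theta>(1) f]] by simp
  qed
  have pi_X: "\<pi> m v \<in> fobj X m" if v: "v \<in> A m" for m v
  proof -
    obtain \<theta> where \<theta>: "\<theta> \<in> Hom Delta m n" "v \<in> set (u m \<theta>)" using AE[OF v] by blast
    then have "\<pi> m v \<in> set (farr X n m \<theta> x)" using pi_u[OF \<theta>(1)] by (metis image_eqI set_map)
    then show ?thesis using slist_in[OF X \<theta>(1) x] by blast
  qed
  have r_id: "r m m (Id Delta m) v = [v]" if v: "v \<in> A m" for m v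
  proof -
    obtain \<theta> where \<theta>: "\<theta> \<in> Hom Delta m n" "v \<in> set (u m \<theta>)" using AE[OF v] by blast
    have "map (r m m (Id Delta m)) (u m \<theta>) = map (\<lambda>v. [v]) (u m \<theta>)"
    proof (rule concat_eq_lengths)
      show "concat (map (r m m (Id Delta m)) (u m \<theta>)) = concat (map (\<lambda>v. [v]) (u m \<theta>))"
        using concat_r[OF \<theta>(1) Delta_id] \<theta>(1) by simp
      show "map length (map (r m m (Id Delta m)) (u m \<theta>)) = map length (map (\<lambda>v. [v]) (u m \<theta>))"
        using len_r[OF _ Delta_id] slist_id[OF X pi_X] u_A[OF \<theta>(1)] by auto
    qed
    then show ?thesis using \<theta>(2) by auto
  qed
  have r_comp: "r m l (Comp Delta l k m f g) v = concat (map (r k l g) (r m k f v))"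
    if v: "v \<in> A m" and f: "f \<in> Hom Delta k m" and g: "g \<in> Hom Delta l k" for m k l f g v
  proof -
    obtain \<theta> where \<theta>: "\<theta> \<in> Hom Delta m n" "v \<in> set (u m \<theta>)" using AE[OF v] by blast
    have "map (r m l (Comp Delta l k m f g)) (u m \<theta>)
        = map (\<lambda>v. concat (map (r k l g) (r m k f v))) (u m \<theta>)"
    proof (rule concat_eq_lengths)
      have "concat (map (\<lambda>v. concat (map (r k l g) (r m k f v))) ws)
          = concat (map (r k l g) (concat (map (r m k f) ws)))" for ws
        by (induction ws) auto
      then show "concat (map (r m l (Comp Delta l k m f g)) (u m \<theta>))
          = concat (map (\<lambda>v. concat (map (r k l g) (r m k f v))) (u m \<theta>))"
        using concat_r[OF \<theta>(1) Delta_comp[OF f g]] concat_r[OF \<theta>(1) f]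
          concat_r[OF Delta_comp[OF \<theta>(1) f] g] Delta_assoc[OF \<theta>(1) f g] by simp
      have "length (r m l (Comp Delta l k m f g) w) = length (concat (map (r k l g) (r m k f w)))"
        if w: "w \<in> A m" for w
      proof -
        have "map (\<lambda>y. length (r k l g y)) (r m k f w)
            = map (\<lambda>y. length (farr X k l g y)) (map (\<pi> k) (r m k f w))"
          using len_r[OF _ g] r_A[OF w f] by auto
        then show ?thesis
          unfolding len_r[OF w Delta_comp[OF f g]] slist_comp[OF X f g pi_X[OF w]] pi_r[OF w f]
          by (simp add: length_concat comp_def)
      qed
      then show "map length (map (r m l (Comp Delta l k m f g)) (u m \<theta>))
          = map length (map (\<lambda>v. concat (map (r k l g) (r m k f v))) (u m \<theta>))"
        using u_A[OF \<theta>(1)] by auto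
    qed
    then show ?thesis using \<theta>(2) by auto
  qed
  define U where "U = mk_slist A r"
  have "slist U"
    unfolding slist_def U_def using r_A r_id r_comp by simp
  moreover have "small (A m)" for m
  proof -
    have "A m \<subseteq> range c" by (auto simp: A_def u_def en_def)
    then show ?thesis using c(2) univ unfolding set_universe_def by blast
  qed
  ultimately have sU: "simplicial_list small U"
    unfolding U_def by (rule simplicial_list_mk_slist)
  have un: "u n (Id Delta n) = [en n (Id Delta n) 0]"
    using slist_id[OF X x] by (simp add: u_def)
  define e where "e = en n (Id Delta n) 0"
  have eA: "e \<in> A n" using u_A[OF Delta_id] un by (simp add: e_def)
  \<comment> \<open>The list \<open>u n (Id Delta n)\<close> has the single term \<open>e\<close>,
    so \<open>concat_r\<close> at the identity is a statement about \<open>e\<close> alone.\<close>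
  have act_e: "farr U n m \<theta> e = u m \<theta>" if "\<theta> \<in> Hom Delta m n" for m \<theta>
    using concat_r[OF Delta_id that] un eA that by (simp add: U_def e_def)
  have "is_gen U n e"
    unfolding is_gen_def
  proof (intro conjI allI ballI)
    show "e \<in> fobj U n" using eA by (simp add: U_def)
  next
    fix m v assume "v \<in> fobj U m"
    then obtain \<theta> where \<theta>: "\<theta> \<in> Hom Delta m n" "v \<in> set (u m \<theta>)" using AE by (auto simp: U_def)
    show "\<exists>!\<theta>. \<theta> \<in> Hom Delta m n \<and> v \<in> set (farr U n m \<theta> e)"
    proof (rule ex1I[of _ \<theta>])
      fix \<theta>' assume "\<theta>' \<in> Hom Delta m n \<and> v \<in> set (farr U n m \<theta>' e)"
      then have t: "\<theta>' \<in> Hom Delta m n" "v \<in> set (u m \<theta>')" using act_e by auto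
      then show "\<theta>' = \<theta>" using \<theta> en_inj[OF t(1) \<theta>(1)] by (auto simp: u_def)
    qed (use \<theta> act_e in auto)
  next
    fix m \<theta> assume \<theta>: "\<theta> \<in> Hom Delta m n"
    show "distinct (farr U n m \<theta> e)"
      unfolding act_e[OF \<theta>] u_def using en_inj[OF \<theta> \<theta>]
      by (auto simp: distinct_map intro!: inj_onI)
  qed
  moreover have "smap U X \<pi>"
    unfolding smap_def U_def using pi_X pi_r by auto
  moreover have "\<pi> n e = x"
    using pi_u[OF Delta_id] un slist_id[OF X x] by (simp add: e_def)
  ultimately show ?thesis
    using shape_smap[OF \<open>slist U\<close> \<open>smap U X \<pi>\<close>, of e n] sU is_gen_in by metis
qed

section \<open>The category of simplicial lists\<close>

lemma Ob_sListCat [simp]: "Ob (sListCat small) = {X. simplicial_list small X}"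
  by (simp add: sListCat_def functor_cat_def simplicial_list_def)

text \<open>Restriction to the simplices makes maps that agree on simplices equal in HOL.\<close>

definition lift :: "'a slist \<Rightarrow> (nat \<Rightarrow> 'a \<Rightarrow> 'b) \<Rightarrow> nat \<Rightarrow> 'a \<Rightarrow> 'b list" where
  "lift X h = (\<lambda>n. \<lambda>x\<in>fobj X n. [h n x])"

lemma lift_apply [simp]: "x \<in> fobj X n \<Longrightarrow> lift X h n x = [h n x]"
  by (simp add: lift_def)

lemma lift_cong: "(\<And>n x. x \<in> fobj X n \<Longrightarrow> g n x = h n x) \<Longrightarrow> lift X g = lift X h"
  by (auto simp: lift_def intro!: ext)

lemma lift_eqD: "lift X g = lift X h \<Longrightarrow> x \<in> fobj X n \<Longrightarrow> g n x = h n x"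
  by (metis lift_apply list.inject)

lemma lift_in_Hom:
  assumes X: "slist X" and h: "smap X Y h"
  shows "lift X h \<in> Hom (sListCat small) X Y"
proof -
  have "concat (map (lift X h m) xs) = map (h m) xs" if "set xs \<subseteq> fobj X m" for m xs
    using that by (induction xs) auto
  then show ?thesis
    using smap_in[OF h] smap_natural[OF h] slist_in[OF X]
    by (auto simp: sListCat_def slistings_def listings_def is_function_def lcomp_def)
      (auto simp: lift_def)
qed

lemma Hom_sListCat_obtain:
  assumes X: "slist X" and \<eta>: "\<eta> \<in> Hom (sListCat small) X Y"
  obtains h where "smap X Y h" "\<eta> = lift X h"
proof
  define h where "h n x = hd (\<eta> n x)" for n x
  have \<eta>1: "\<eta> n x = [h n x]" if "x \<in> fobj X n" for n x
  proof -
    have "length (\<eta> n x) = 1" using \<eta> that by (simp add: sListCat_def is_function_def)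
    then show ?thesis by (auto simp: h_def length_Suc_conv)
  qed
  have \<eta>l: "\<eta> n \<in> listings (fobj X n) (fobj Y n)" for n
    using \<eta> by (simp add: sListCat_def slistings_def)
  show "\<eta> = lift X h"
  proof
    fix n show "\<eta> n = lift X h n"
      using \<eta>l[of n] \<eta>1 by (intro extensionalityI[of _ "fobj X n"]) (auto simp: listings_def PiE_def lift_def)
  qed
  show "smap X Y h"
    unfolding smap_def
  proof (intro conjI allI ballI)
    fix n x assume x: "x \<in> fobj X n"
    have "set (\<eta> n x) \<subseteq> fobj Y n" using \<eta>l[of n] x by (auto simp: listings_def PiE_def Pi_def lists_eq_set)
    then show "h n x \<in> fobj Y n" using \<eta>1[OF x] by simp
  next
    fix m n f x assume f: "f \<in> Hom Delta m n" and x: "x \<in> fobj X n"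
    have "concat (map (\<eta> m) xs) = map (h m) xs" if "set xs \<subseteq> fobj X m" for xs
      using that \<eta>1 by (induction xs) auto
    moreover have "lcomp (fobj X n) (\<eta> m) (farr X n m f) = lcomp (fobj X n) (farr Y n m f) (\<eta> n)"
      using \<eta> f by (simp add: sListCat_def slistings_def)
    from fun_cong[OF this, of x] have "concat (map (\<eta> m) (farr X n m f x)) = farr Y n m f (h n x)"
      using x \<eta>1 by (simp add: lcomp_def)
    ultimately show "farr Y n m f (h n x) = map (h m) (farr X n m f x)"
      using slist_in[OF X f x] by simp
  qed
qed

lemma Comp_lift:
  assumes "smap X Y g"
  shows "Comp (sListCat small) X Y Z (lift Y h) (lift X g) = lift X (\<lambda>n x. h n (g n x))"
  using smap_in[OF assms]
  by (auto simp: sListCat_def functor_cat_def lcomp_def lift_def fun_eq_iff)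

lemma Id_sListCat: "Id (sListCat small) X = lift X (\<lambda>n x. x)"
  by (auto simp: sListCat_def functor_cat_def lift_def fun_eq_iff)

text \<open>Through \<open>lift\<close>, composition becomes composition of functions, and the
  category laws follow without calculating with concatenations.\<close>

lemma category_sListCat: "category (sListCat small)"
proof (rule categoryI)
  fix X assume "X \<in> Ob (sListCat small)"
  then show "Id (sListCat small) X \<in> Hom (sListCat small) X X"
    using lift_in_Hom[OF simplicial_list_slist smap_id] by (auto simp: Id_sListCat)
next
  fix X Y Z f g assume "X \<in> Ob (sListCat small)" "Y \<in> Ob (sListCat small)"
    "f \<in> Hom (sListCat small) X Y" "g \<in> Hom (sListCat small) Y Z"
  then obtain h k where "slist X" "smap X Y h" "f = lift X h" "smap Y Z k" "g = lift Y k"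
    using Hom_sListCat_obtain simplicial_list_slist by (metis Ob_sListCat mem_Collect_eq)
  then show "Comp (sListCat small) X Y Z g f \<in> Hom (sListCat small) X Z"
    by (simp add: Comp_lift lift_in_Hom smap_comp)
next
  fix X Y f assume "X \<in> Ob (sListCat small)" "f \<in> Hom (sListCat small) X Y"
  then obtain h where h: "smap X Y h" "f = lift X h"
    using Hom_sListCat_obtain simplicial_list_slist by (metis Ob_sListCat mem_Collect_eq)
  then show "Comp (sListCat small) X X Y f (Id (sListCat small) X) = f"
    and "Comp (sListCat small) X Y Y (Id (sListCat small) Y) f = f"
    by (simp_all add: Comp_lift Id_sListCat smap_id)
next
  fix X Y Z W f g h assume "X \<in> Ob (sListCat small)" "Y \<in> Ob (sListCat small)" "Z \<in> Ob (sListCat small)"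
    "f \<in> Hom (sListCat small) X Y" "g \<in> Hom (sListCat small) Y Z" "h \<in> Hom (sListCat small) Z W"
  moreover from this obtain f' g' h' where "smap X Y f'" "f = lift X f'" "smap Y Z g'" "g = lift Y g'"
      "smap Z W h'" "h = lift Z h'"
    using Hom_sListCat_obtain simplicial_list_slist by (metis Ob_sListCat mem_Collect_eq)
  ultimately show "Comp (sListCat small) X Z W h (Comp (sListCat small) X Y Z g f) =
      Comp (sListCat small) X Y W (Comp (sListCat small) Y Z W h g) f"
    by (simp add: Comp_lift smap_comp)
qed

lemma isomorphic_sListCat_iff:
  assumes X: "slist X" and Y: "slist Y"
  shows "isomorphic (sListCat small) X Y \<longleftrightarrow> (\<exists>h g. smap X Y h \<and> smap Y X g \<and>
    (\<forall>n. \<forall>x\<in>fobj X n. g n (h n x) = x) \<and> (\<forall>n. \<forall>y\<in>fobj Y n. h n (g n y) = y))"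
  (is "_ \<longleftrightarrow> ?R")
proof
  assume "isomorphic (sListCat small) X Y"
  then obtain f f' where f: "f \<in> Hom (sListCat small) X Y" "f' \<in> Hom (sListCat small) Y X"
    and i: "Comp (sListCat small) X Y X f' f = Id (sListCat small) X"
      "Comp (sListCat small) Y X Y f f' = Id (sListCat small) Y"
    unfolding isomorphic_def is_iso_def by blast
  obtain h where h: "smap X Y h" "f = lift X h" using Hom_sListCat_obtain[OF X f(1)] .
  obtain g where g: "smap Y X g" "f' = lift Y g" using Hom_sListCat_obtain[OF Y f(2)] .
  have "lift X (\<lambda>n x. g n (h n x)) = lift X (\<lambda>n x. x)" "lift Y (\<lambda>n x. h n (g n x)) = lift Y (\<lambda>n x. x)"
    using i h g by (simp_all add: Comp_lift Id_sListCat)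
  then show ?R using h(1) g(1) by (intro exI[of _ h] exI[of _ g]) (auto dest: lift_eqD)
next
  assume ?R
  then obtain h g where hg: "smap X Y h" "smap Y X g" "\<And>n x. x \<in> fobj X n \<Longrightarrow> g n (h n x) = x"
    "\<And>n y. y \<in> fobj Y n \<Longrightarrow> h n (g n y) = y" by blast
  show "isomorphic (sListCat small) X Y"
    unfolding isomorphic_def is_iso_def
    by (intro exI[of _ "lift X h"] conjI bexI[of _ "lift Y g"] lift_in_Hom X Y hg)
      (auto simp: Comp_lift Id_sListCat hg intro!: lift_cong)
qed

section \<open>The presheaf of a simplicial list\<close>

locale slist_skeleton =
  fixes small :: "'a set \<Rightarrow> bool" and \<F> :: "'a slist set"
  assumes univ: "set_universe small"
    and skeleton: "skeleton_of (sListCat small) (fundamental_objects small) \<F>"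
begin

abbreviation sl :: "('a slist, nat \<Rightarrow> 'a \<Rightarrow> 'a list) cat" where
  "sl \<equiv> sListCat small"

abbreviation Fop :: "('a slist, nat \<Rightarrow> 'a \<Rightarrow> 'a list) cat" where
  "Fop \<equiv> op_cat (full_subcat sl \<F>)"

lemma small_subset: "small T \<Longrightarrow> S \<subseteq> T \<Longrightarrow> small S"
  using univ unfolding set_universe_def by blast

lemma small_image: "small S \<Longrightarrow> small (f ` S)" for f :: "'a \<Rightarrow> 'a"
  using univ unfolding set_universe_def by blast

lemma small_UN: "small I \<Longrightarrow> (\<And>i. i \<in> I \<Longrightarrow> small (A i)) \<Longrightarrow> small (\<Union>i\<in>I. A i)" for I :: "'a set"
  using univ unfolding set_universe_def by blast

lemma F_simplicial_list: "U \<in> \<F> \<Longrightarrow> simplicial_list small U"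
  using skeleton by (auto simp: skeleton_of_def fundamental_objects_def)

lemma F_slist: "U \<in> \<F> \<Longrightarrow> slist U"
  using F_simplicial_list simplicial_list_slist by blast

lemma Ob_Int_F [simp]: "{X. simplicial_list small X} \<inter> \<F> = \<F>"
  using F_simplicial_list by auto

section \<open>Generators and codes of the objects of \<open>\<F>\<close>\<close>

definition dim :: "'a slist \<Rightarrow> nat" where
  "dim U = (THE n. \<exists>e. is_gen U n e)"

definition gn :: "'a slist \<Rightarrow> 'a" where
  "gn U = (THE e. is_gen U (dim U) e)"

definition code :: "'a slist \<Rightarrow> nat set" where
  "code U = shape U (dim U) (gn U)"

lemma is_gen_eq:
  assumes "slist U" "is_gen U n e"
  shows "dim U = n \<and> gn U = e"
proof -
  have *: "n' = n \<and> e' = e" if "is_gen U n' e'" for n' e'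
    using is_gen_unique[OF assms(1) that assms(2)] .
  have "dim U = n"
    unfolding dim_def by (rule the_equality) (metis assms(2), metis *)
  moreover have "(THE e. is_gen U n e) = e"
    by (rule the_equality) (metis assms(2), metis *)
  ultimately show ?thesis by (simp add: gn_def)
qed

lemma gen:
  assumes "U \<in> \<F>"
  shows "is_gen U (dim U) (gn U)"
proof -
  have "fundamental U" using assms skeleton by (auto simp: skeleton_of_def fundamental_objects_def)
  then obtain n e where "is_gen U n e" using fundamental_iff_gen[OF F_slist[OF assms]] by blast
  then show ?thesis using is_gen_eq[OF F_slist[OF assms]] by metis
qed

lemma gn_in: "U \<in> \<F> \<Longrightarrow> gn U \<in> fobj U (dim U)"
  using is_gen_in[OF gen] .

lemma dim_of_code: "code U = shape X n x \<Longrightarrow> dim U = n"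
  unfolding code_def by (rule shape_eq_dim)

text \<open>Equal codes give maps both ways by \<open>smap_of_shape\<close>. The composites fix the
  generators, hence are identities, and isomorphic objects of a skeleton coincide. So
  \<open>\<F>\<close> embeds into \<open>nat set\<close>.\<close>

lemma code_inj:
  assumes U: "U \<in> \<F>" and V: "V \<in> \<F>" and eq: "code U = code V"
  shows "U = V"
proof -
  have d: "dim V = dim U" using dim_of_code[OF eq[unfolded code_def[of V]]] by simp
  obtain h where h: "smap U V h" "h (dim U) (gn U) = gn V"
    using smap_of_shape[OF F_slist[OF U] gen[OF U] F_slist[OF V], of "gn V"] gn_in[OF V] d eq
    unfolding code_def by auto
  obtain g where g: "smap V U g" "g (dim U) (gn V) = gn U"
    using smap_of_shape[OF F_slist[OF V] gen[OF V] F_slist[OF U], of "gn U"] gn_in[OF U] d eq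
    unfolding code_def by auto
  have "g n (h n x) = x" if "x \<in> fobj U n" for n x
    using smap_eq_on_gen[OF gen[OF U] smap_comp[OF h(1) g(1)] smap_id _ that] h g by simp
  moreover have "h n (g n x) = x" if "x \<in> fobj V n" for n x
    using smap_eq_on_gen[OF gen[OF V] smap_comp[OF g(1) h(1)] smap_id _ that] h g d by simp
  ultimately have "isomorphic sl U V"
    using h(1) g(1) unfolding isomorphic_sListCat_iff[OF F_slist[OF U] F_slist[OF V]] by blast
  moreover have "isomorphic sl U U"
    using isomorphic_refl[OF category_sListCat] F_simplicial_list[OF U] by simp
  moreover have "\<exists>!b. b \<in> \<F> \<and> isomorphic sl U b"
    using skeleton U by (auto simp: skeleton_of_def)
  ultimately show ?thesis using U V by blast
qed

text \<open>The perfect factor of the listing given by \<open>x\<close>, as an object of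
  \<open>\<F>\<close>; it names the summand of the disjoint union in which \<open>x\<close>
  lies.\<close>

definition cl :: "'a slist \<Rightarrow> nat \<Rightarrow> 'a \<Rightarrow> 'a slist" where
  "cl X n x = (THE U. U \<in> \<F> \<and> code U = shape X n x)"

lemma cl_eqI: "U \<in> \<F> \<Longrightarrow> code U = shape X n x \<Longrightarrow> cl X n x = U"
  unfolding cl_def using code_inj by (intro the_equality) auto

text \<open>The list from \<open>realization\<close> need not belong to \<open>\<F>\<close>. An
  isomorphism to its representative carries the generator to the generator and preserves the
  shape.\<close>

lemma cl:
  assumes X: "slist X" and x: "x \<in> fobj X n"
  shows "cl X n x \<in> \<F>" "code (cl X n x) = shape X n x" "dim (cl X n x) = n"
proof -
  obtain U e where U: "simplicial_list small U" "is_gen U n e" "shape U n e = shape X n x"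
    using realization[OF univ X x] by blast
  note sU = simplicial_list_slist[OF U(1)]
  have "U \<in> fundamental_objects small"
    using U fundamental_iff_gen[OF sU] by (auto simp: fundamental_objects_def)
  then obtain V where V: "V \<in> \<F>" "isomorphic sl U V"
    using skeleton unfolding skeleton_of_def by blast
  obtain h g where hg: "smap U V h" "smap V U g" "\<And>n x. x \<in> fobj U n \<Longrightarrow> g n (h n x) = x"
    "\<And>n y. y \<in> fobj V n \<Longrightarrow> h n (g n y) = y"
    using V(2) unfolding isomorphic_sListCat_iff[OF sU F_slist[OF V(1)]] by blast
  have "is_gen V n (h n e)" using is_gen_smap_iso[OF hg U(2)] .
  then have "dim V = n \<and> gn V = h n e" using is_gen_eq[OF F_slist[OF V(1)]] by blast
  then have "code V = shape X n x"
    using shape_smap[OF sU hg(1) is_gen_in[OF U(2)]] U(3) by (simp add: code_def)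
  then show "cl X n x \<in> \<F>" "code (cl X n x) = shape X n x" "dim (cl X n x) = n"
    using cl_eqI[OF V(1)] V(1) dim_of_code by auto
qed

text \<open>Maps respect the decomposition of simplices into summands.\<close>

lemma cl_smap: "slist X \<Longrightarrow> smap X Y h \<Longrightarrow> x \<in> fobj X n \<Longrightarrow> cl Y n (h n x) = cl X n x"
  by (simp add: cl_def shape_smap)

lemma cl_gn: "U \<in> \<F> \<Longrightarrow> cl U (dim U) (gn U) = U"
  by (rule cl_eqI) (simp_all add: code_def)

text \<open>
  By \<open>smap_of_shape\<close>, \<open>Ev X U\<close> is the set of maps \<open>U \<rightarrow> X\<close>, each identified with the image of the
  generator; \<open>hat X U x\<close> is the map with image \<open>x\<close>.
\<close>

definition Ev :: "'a slist \<Rightarrow> 'a slist \<Rightarrow> 'a set" where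
  "Ev X U = {x \<in> fobj X (dim U). shape X (dim U) x = code U}"

definition hat :: "'a slist \<Rightarrow> 'a slist \<Rightarrow> 'a \<Rightarrow> nat \<Rightarrow> 'a \<Rightarrow> 'a" where
  "hat X U x = (SOME h. smap U X h \<and> h (dim U) (gn U) = x)"

lemma Ev_in: "x \<in> Ev X U \<Longrightarrow> x \<in> fobj X (dim U)"
  by (simp add: Ev_def)

lemma cl_Ev: "U \<in> \<F> \<Longrightarrow> x \<in> Ev X U \<Longrightarrow> cl X (dim U) x = U"
  by (rule cl_eqI) (simp_all add: Ev_def)

lemma Ev_cl: "slist X \<Longrightarrow> x \<in> fobj X n \<Longrightarrow> x \<in> Ev X (cl X n x)"
  by (simp add: Ev_def cl)

lemma Ev_smap:
  assumes "slist X" "smap X Y h" "x \<in> Ev X U"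
  shows "h (dim U) x \<in> Ev Y U"
  using assms shape_smap[OF assms(1,2)] smap_in[OF assms(2)] by (auto simp: Ev_def)

lemma gn_Ev: "U \<in> \<F> \<Longrightarrow> gn U \<in> Ev U U"
  by (simp add: Ev_def gn_in code_def)

lemma
  assumes X: "slist X" and U: "U \<in> \<F>" and x: "x \<in> Ev X U"
  shows hat_smap: "smap U X (hat X U x)" and hat_gn: "hat X U x (dim U) (gn U) = x"
proof -
  have "\<exists>h. smap U X h \<and> h (dim U) (gn U) = x"
    using smap_of_shape[OF F_slist[OF U] gen[OF U] X, of x] x by (auto simp: Ev_def code_def)
  from someI_ex[OF this] show "smap U X (hat X U x)" "hat X U x (dim U) (gn U) = x"
    by (simp_all add: hat_def)
qed

lemma hat_unique:
  assumes X: "slist X" and U: "U \<in> \<F>" and h: "smap U X h" and x: "h (dim U) (gn U) = x"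
    and v: "v \<in> fobj U m"
  shows "hat X U x m v = h m v"
proof -
  have "x \<in> Ev X U" using Ev_smap[OF F_slist[OF U] h gn_Ev[OF U]] x by simp
  then show ?thesis
    using smap_eq_on_gen[OF gen[OF U] hat_smap[OF X U] h _ v] hat_gn[OF X U] x by simp
qed

text \<open>Associativity of composition, read on generators: both sides are maps out of
  \<open>U\<close> with the same value at \<open>gn U\<close>.\<close>

lemma hat_comp:
  assumes X: "slist X" and V: "V \<in> \<F>" and U: "U \<in> \<F>" and x: "x \<in> Ev X V" and v: "v \<in> Ev V U"
    and w: "w \<in> fobj U m"
  shows "hat X U (hat X V x (dim U) v) m w = hat X V x m (hat V U v m w)"
  by (rule hat_unique[OF X U smap_comp[OF hat_smap[OF F_slist[OF V] U v] hat_smap[OF X V x]] _ w])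
    (simp add: hat_gn[OF F_slist[OF V] U v])

text \<open>Restriction along \<open>\<phi>\<close> is precomposition, transported to images of
  generators: composing \<open>hat X V x\<close> with \<open>\<phi>\<close> gives the map that sends
  \<open>gn U\<close> to the value below. \<open>hd\<close> reads the only term of a function-like
  listing.\<close>

definition Phi :: "'a slist \<Rightarrow> ('a slist, nat \<Rightarrow> 'a \<Rightarrow> 'a list, 'a set, 'a \<Rightarrow> 'a) functor_data" where
  "Phi X = \<lparr>fobj = (\<lambda>U\<in>\<F>. Ev X U),
     farr = (\<lambda>V U \<phi>. if V \<in> \<F> \<and> U \<in> \<F> \<and> \<phi> \<in> Hom sl U V
       then (\<lambda>x\<in>Ev X V. hat X V x (dim U) (hd (\<phi> (dim U) (gn U)))) else undefined)\<rparr>"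

lemma fobj_Phi [simp]: "U \<in> \<F> \<Longrightarrow> fobj (Phi X) U = Ev X U"
  by (simp add: Phi_def)

lemma farr_Phi:
  assumes "U \<in> \<F>" "V \<in> \<F>" "smap U V h"
  shows "farr (Phi X) V U (lift U h) = (\<lambda>x\<in>Ev X V. hat X V x (dim U) (h (dim U) (gn U)))"
  using assms lift_in_Hom[OF F_slist[OF assms(1)] assms(3)] gn_in[OF assms(1)] by (simp add: Phi_def)

lemma Phi_arr_in:
  assumes X: "slist X" and "U \<in> \<F>" "V \<in> \<F>" "smap U V h" "x \<in> Ev X V"
  shows "hat X V x (dim U) (h (dim U) (gn U)) \<in> Ev X U"
  using Ev_smap[OF F_slist[OF assms(2)] smap_comp[OF assms(4) hat_smap[OF X assms(3,5)]] gn_Ev[OF assms(2)]] .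

lemma Hom_F_obtain:
  assumes "U \<in> \<F>" "\<phi> \<in> Hom sl U V"
  obtains h where "smap U V h" "\<phi> = lift U h"
  using Hom_sListCat_obtain[OF F_slist[OF assms(1)] assms(2)] .

lemma is_functor_Phi:
  assumes X: "simplicial_list small X"
  shows "is_functor Fop (SetCat small) (Phi X)"
proof (rule functorI)
  note sX = simplicial_list_slist[OF X]
  fix U assume "U \<in> Ob Fop" then have U: "U \<in> \<F>" by simp
  have "small (fobj X (dim U))" using X by (simp add: simplicial_list_iff)
  then show "fobj (Phi X) U \<in> Ob (SetCat small)"
    using U small_subset[of "fobj X (dim U)" "Ev X U"] Ev_in by auto
  show "farr (Phi X) U U (Id Fop U) = Id (SetCat small) (fobj (Phi X) U)"
    using U hat_gn[OF sX U] by (auto simp: Id_sListCat farr_Phi smap_id)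
next
  note sX = simplicial_list_slist[OF X]
  fix V U \<phi> assume "V \<in> Ob Fop" "U \<in> Ob Fop" "\<phi> \<in> Hom Fop V U"
  then have V: "V \<in> \<F>" and U: "U \<in> \<F>" and "\<phi> \<in> Hom sl U V" by auto
  then obtain h where "smap U V h" "\<phi> = lift U h" using Hom_F_obtain by blast
  then show "farr (Phi X) V U \<phi> \<in> Hom (SetCat small) (fobj (Phi X) V) (fobj (Phi X) U)"
    using U V Phi_arr_in[OF sX] by (auto simp: farr_Phi)
next
  note sX = simplicial_list_slist[OF X]
  fix W V U \<psi> \<phi> assume "W \<in> Ob Fop" "V \<in> Ob Fop" "U \<in> Ob Fop" "\<psi> \<in> Hom Fop W V" "\<phi> \<in> Hom Fop V U"
  then have W: "W \<in> \<F>" and V: "V \<in> \<F>" and U: "U \<in> \<F>" and "\<psi> \<in> Hom sl V W" "\<phi> \<in> Hom sl U V" by auto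
  then obtain g h where g: "smap V W g" "\<psi> = lift V g" and h: "smap U V h" "\<phi> = lift U h"
    using Hom_F_obtain by metis
  have hg: "h (dim U) (gn U) \<in> fobj V (dim U)" using smap_in[OF h(1) gn_in[OF U]] .
  \<comment> \<open>By uniqueness, the \<open>hat\<close> of the restricted simplex is
    \<open>hat X W x\<close> after \<open>g\<close>, so restricting twice is restricting along the
    composite.\<close>
  have "hat X W x (dim U) (g (dim U) (h (dim U) (gn U)))
      = hat X V (hat X W x (dim V) (g (dim V) (gn V))) (dim U) (h (dim U) (gn U))"
    if x: "x \<in> Ev X W" for x
    using hat_unique[OF sX V smap_comp[OF g(1) hat_smap[OF sX W x]] refl hg] by simp
  then have "farr (Phi X) W U (lift U (\<lambda>n x. g n (h n x)))
      = compose (Ev X W) (farr (Phi X) V U \<phi>) (farr (Phi X) W V \<psi>)"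
    unfolding g(2) h(2) using U V W g(1) h(1) Phi_arr_in[OF sX V W g(1)]
    by (simp add: farr_Phi smap_comp compose_def fun_eq_iff restrict_def)
  then show "farr (Phi X) W U (Comp Fop W V U \<phi> \<psi>) = Comp (SetCat small) (fobj (Phi X) W)
      (fobj (Phi X) V) (fobj (Phi X) U) (farr (Phi X) V U \<phi>) (farr (Phi X) W V \<psi>)"
    using g h W by (simp add: Comp_lift)
qed (auto simp: Phi_def)

section \<open>Action on morphisms and full faithfulness\<close>

definition PhiA :: "'a slist \<Rightarrow> (nat \<Rightarrow> 'a \<Rightarrow> 'a list) \<Rightarrow> 'a slist \<Rightarrow> 'a \<Rightarrow> 'a" where
  "PhiA X \<eta> = (\<lambda>U\<in>\<F>. \<lambda>x\<in>Ev X U. hd (\<eta> (dim U) x))"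

lemma PhiA_lift: "PhiA X (lift X h) = (\<lambda>U\<in>\<F>. \<lambda>x\<in>Ev X U. h (dim U) x)"
  unfolding PhiA_def by (intro restrict_ext) (simp add: Ev_in)

lemma PhiA_nat_trans:
  assumes X: "slist X" and Y: "slist Y" and h: "smap X Y h"
  shows "PhiA X (lift X h) \<in> nat_trans Fop (SetCat small) (Phi X) (Phi Y)"
proof -
  have "compose (Ev X V) (\<lambda>x\<in>Ev X U. h (dim U) x) (farr (Phi X) V U \<phi>)
      = compose (Ev X V) (farr (Phi Y) V U \<phi>) (\<lambda>x\<in>Ev X V. h (dim V) x)"
    if V: "V \<in> \<F>" and U: "U \<in> \<F>" and \<phi>: "\<phi> \<in> Hom sl U V" for V U \<phi>
  proof -
    obtain g where g: "smap U V g" "\<phi> = lift U g" using Hom_F_obtain[OF U \<phi>] .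
    \<comment> \<open>\<open>h\<close> after \<open>hat X V x\<close> is a map out of
      \<open>V\<close> sending the generator to \<open>h (dim V) x\<close>, hence is the
      \<open>hat\<close> of that simplex.\<close>
    have "h (dim U) (hat X V x (dim U) (g (dim U) (gn U)))
        = hat Y V (h (dim V) x) (dim U) (g (dim U) (gn U))" if x: "x \<in> Ev X V" for x
      using hat_unique[OF Y V smap_comp[OF hat_smap[OF X V x] h] refl smap_in[OF g(1) gn_in[OF U]]]
        hat_gn[OF X V x] by simp
    then show ?thesis
      unfolding g(2) using U V g(1) Phi_arr_in[OF X U V g(1)] Ev_smap[OF X h]
      by (simp add: farr_Phi compose_def fun_eq_iff restrict_def)
  qed
  then show ?thesis
    using Ev_smap[OF X h] by (auto simp: nat_trans_def PhiA_lift)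
qed

definition PhiF where
  "PhiF = \<lparr>fobj = (\<lambda>X\<in>Ob sl. Phi X),
     farr = (\<lambda>X Y \<eta>. if X \<in> Ob sl \<and> Y \<in> Ob sl \<and> \<eta> \<in> Hom sl X Y then PhiA X \<eta> else undefined)\<rparr>"

lemma is_functor_PhiF: "is_functor sl (functor_cat Fop (SetCat small)) PhiF"
proof (rule functorI)
  fix X assume "X \<in> Ob sl" then have X: "simplicial_list small X" by simp
  then show "fobj PhiF X \<in> Ob (functor_cat Fop (SetCat small))"
    by (simp add: PhiF_def is_functor_Phi)
  show "farr PhiF X X (Id sl X) = Id (functor_cat Fop (SetCat small)) (fobj PhiF X)"
    using X cat_id[OF category_sListCat, of X small]
    by (auto simp: PhiF_def Id_sListCat PhiA_lift intro!: restrict_ext)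
next
  fix X Y \<eta> assume a: "X \<in> Ob sl" "Y \<in> Ob sl" "\<eta> \<in> Hom sl X Y"
  then have X: "slist X" and Y: "slist Y" using simplicial_list_slist by auto
  obtain h where "smap X Y h" "\<eta> = lift X h" using Hom_sListCat_obtain[OF X a(3)] .
  then show "farr PhiF X Y \<eta> \<in> Hom (functor_cat Fop (SetCat small)) (fobj PhiF X) (fobj PhiF Y)"
    using a PhiA_nat_trans[OF X Y] by (simp add: PhiF_def)
next
  fix X Y Z f g assume a: "X \<in> Ob sl" "Y \<in> Ob sl" "Z \<in> Ob sl" "f \<in> Hom sl X Y" "g \<in> Hom sl Y Z"
  then have X: "slist X" and Y: "slist Y" using simplicial_list_slist by auto
  obtain h where h: "smap X Y h" "f = lift X h" using Hom_sListCat_obtain[OF X a(4)] .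
  obtain k where k: "smap Y Z k" "g = lift Y k" using Hom_sListCat_obtain[OF Y a(5)] .
  have "lift X (\<lambda>n x. k n (h n x)) \<in> Hom sl X Z" using lift_in_Hom[OF X smap_comp[OF h(1) k(1)]] .
  then have 1: "farr PhiF X Z (Comp sl X Y Z g f) = PhiA X (lift X (\<lambda>n x. k n (h n x)))"
    using a h k by (simp add: PhiF_def Comp_lift)
  have 2: "farr PhiF X Y f = PhiA X (lift X h)" "farr PhiF Y Z g = PhiA Y (lift Y k)"
    using a h k by (simp_all add: PhiF_def)
  show "farr PhiF X Z (Comp sl X Y Z g f) = Comp (functor_cat Fop (SetCat small))
      (fobj PhiF X) (fobj PhiF Y) (fobj PhiF Z) (farr PhiF Y Z g) (farr PhiF X Y f)"
    unfolding 1 2 PhiA_lift using Ev_smap[OF X h(1)] a(1-3)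
    by (auto simp: PhiF_def compose_def intro!: restrict_ext)
qed (auto simp: PhiF_def)

text \<open>Every \<open>x\<close> lies in \<open>Ev X (cl X n x)\<close>, so the components on all
  \<open>Ev X U\<close> determine a map, and a given \<open>\<alpha>\<close> can be glued
  degreewise. Naturality of \<open>\<alpha>\<close> along arrows of \<open>\<F>\<close> gives
  compatibility with the simplicial operators.\<close>

lemma PhiF_fully_faithful:
  assumes "X \<in> Ob sl" "Y \<in> Ob sl"
  shows "bij_betw (farr PhiF X Y) (Hom sl X Y)
    (Hom (functor_cat Fop (SetCat small)) (fobj PhiF X) (fobj PhiF Y))"
proof -
  have X: "slist X" and Y: "slist Y" using assms simplicial_list_slist by auto
  have "inj_on (PhiA X) (Hom sl X Y)"
  proof (rule inj_onI)
    fix \<eta> \<eta>' assume "\<eta> \<in> Hom sl X Y" "\<eta>' \<in> Hom sl X Y" and eq: "PhiA X \<eta> = PhiA X \<eta>'"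
    then obtain h h' where h: "\<eta> = lift X h" "\<eta>' = lift X h'" using Hom_sListCat_obtain[OF X] by metis
    have "h n x = h' n x" if x: "x \<in> fobj X n" for n x
      using fun_cong[OF fun_cong[OF eq, of "cl X n x"], of x] cl[OF X x] Ev_cl[OF X x]
      by (simp add: h PhiA_lift)
    then show "\<eta> = \<eta>'" unfolding h by (rule lift_cong)
  qed
  moreover have "\<exists>\<eta>\<in>Hom sl X Y. PhiA X \<eta> = \<alpha>"
    if \<alpha>: "\<alpha> \<in> nat_trans Fop (SetCat small) (Phi X) (Phi Y)" for \<alpha>
  proof -
    define h where "h n x = \<alpha> (cl X n x) x" for n x
    have \<alpha>_in: "\<alpha> U \<in> Ev X U \<rightarrow>\<^sub>E Ev Y U" if "U \<in> \<F>" for U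
      using nat_trans_arr[OF \<alpha>, of U] that by simp
    have h_Ev: "h n x \<in> Ev Y (cl X n x)" if x: "x \<in> fobj X n" for n x
      using \<alpha>_in[OF cl(1)[OF X x]] Ev_cl[OF X x] by (auto simp: h_def)
    have "smap X Y h"
      unfolding smap_def
    proof (intro conjI allI ballI)
      fix n x assume x: "x \<in> fobj X n"
      show "h n x \<in> fobj Y n" using Ev_in[OF h_Ev[OF x]] cl(3)[OF X x] by simp
    next
      fix m n f x assume f: "f \<in> Hom Delta m n" and x: "x \<in> fobj X n"
      define U where "U = cl X n x"
      have U: "U \<in> \<F>" and dU: "dim U = n" and xE: "x \<in> Ev X U" and yE: "h n x \<in> Ev Y U"
        using cl[OF X x] Ev_cl[OF X x] h_Ev[OF x] by (simp_all add: U_def)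
      note gU = gn_in[OF U, unfolded dU]
      have 1: "farr X n m f x = map (hat X U x m) (farr U n m f (gn U))"
        using smap_natural[OF hat_smap[OF X U xE] f gU] hat_gn[OF X U xE] dU by simp
      have 2: "farr Y n m f (h n x) = map (hat Y U (h n x) m) (farr U n m f (gn U))"
        using smap_natural[OF hat_smap[OF Y U yE] f gU] hat_gn[OF Y U yE] dU by simp
      \<comment> \<open>The simplex \<open>v\<close> of \<open>U\<close> is named by the arrow
        \<open>hat U V v\<close> from its class \<open>V\<close>; the naturality square of
        \<open>\<alpha>\<close> along this arrow, evaluated at \<open>x\<close>, is the
        claim.\<close>
      have "h m (hat X U x m v) = hat Y U (h n x) m v" if v: "v \<in> fobj U m" for v
      proof -
        define V where "V = cl U m v"
        note sU = F_slist[OF U]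
        have V: "V \<in> \<F>" and dV: "dim V = m" and vE: "v \<in> Ev U V"
          using cl[OF sU v] Ev_cl[OF sU v] by (simp_all add: V_def)
        have c: "cl X m (hat X U x m v) = V"
          using cl_smap[OF sU hat_smap[OF X U xE] v] by (simp add: V_def)
        have s: "smap V U (hat U V v)" and g: "hat U V v m (gn V) = v"
          using hat_smap[OF sU V vE] hat_gn[OF sU V vE] dV by simp_all
        have "lift V (hat U V v) \<in> Hom Fop U V"
          using lift_in_Hom[OF F_slist[OF V] s] by simp
        from nat_trans_natural[OF \<alpha> _ _ this]
        have "compose (Ev X U) (\<alpha> V) (farr (Phi X) U V (lift V (hat U V v)))
            = compose (Ev X U) (farr (Phi Y) U V (lift V (hat U V v))) (\<alpha> U)"
          using U V by simp
        from fun_cong[OF this, of x]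
        have "\<alpha> V (hat X U x m v) = hat Y U (\<alpha> U x) m v"
          using xE yE U V s g dV dU \<alpha>_in[OF U] by (auto simp: farr_Phi compose_def)
        then show ?thesis using c by (simp add: h_def U_def)
      qed
      then show "farr Y n m f (h n x) = map (h m) (farr X n m f x)"
        unfolding 1 2 using slist_in[OF F_slist[OF U] f gU] by auto
    qed
    moreover have "PhiA X (lift X h) = \<alpha>"
    proof (rule nat_trans_ext[OF PhiA_nat_trans[OF X Y \<open>smap X Y h\<close>] \<alpha>])
      fix U assume "U \<in> Ob Fop"
      then have U: "U \<in> \<F>" by simp
      show "PhiA X (lift X h) U = \<alpha> U"
        using \<alpha>_in[OF U] U
        by (intro extensionalityI[of _ "Ev X U"]) (auto simp: PhiA_lift h_def cl_Ev PiE_def)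
    qed
    ultimately show ?thesis using lift_in_Hom[OF X] by blast
  qed
  moreover have "PhiA X \<eta> \<in> nat_trans Fop (SetCat small) (Phi X) (Phi Y)" if "\<eta> \<in> Hom sl X Y" for \<eta>
    using Hom_sListCat_obtain[OF X that] PhiA_nat_trans[OF X Y] by metis
  ultimately have "bij_betw (PhiA X) (Hom sl X Y) (nat_trans Fop (SetCat small) (Phi X) (Phi Y))"
    by (auto simp: bij_betw_def)
  moreover have "farr PhiF X Y \<eta> = PhiA X \<eta>" if "\<eta> \<in> Hom sl X Y" for \<eta>
    using that assms by (simp add: PhiF_def)
  moreover have "fobj PhiF X = Phi X" "fobj PhiF Y = Phi Y"
    using assms by (simp_all add: PhiF_def)
  ultimately show ?thesis
    using bij_betw_cong[of "Hom sl X Y" "farr PhiF X Y" "PhiA X"] by simp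
qed

text \<open>A simplex tagged by \<open>U\<close> and \<open>p\<close> should be the image of
  \<open>gn U\<close> under a map from \<open>U\<close>. Its lists are therefore copied from
  \<open>U\<close>, and each term \<open>v\<close> is replaced by the restriction of
  \<open>p\<close> along the arrow naming \<open>v\<close>.\<close>

lemma PhiF_essentially_surjective:
  assumes P: "is_functor Fop (SetCat small) P"
  shows "\<exists>X\<in>Ob sl. isomorphic (functor_cat Fop (SetCat small)) (fobj PhiF X) P"
proof -
  obtain c :: "nat set \<Rightarrow> 'a" where c: "inj c" "small (range c)"
    using univ by (auto simp: set_universe_def)
  \<comment> \<open>An infinite type is in bijection with its square, which leaves room in
    \<open>'a\<close> for pairs.\<close>
  have inf: "infinite (UNIV :: 'a set)"
    using finite_imageD[OF finite_subset[OF subset_UNIV, of "range c"] c(1)] Finite_Set.finite_set by auto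
  obtain pr :: "'a \<times> 'a \<Rightarrow> 'a" where pr: "inj pr"
    using card_of_Times_same_infinite[OF inf] card_of_ordIso[of "UNIV \<times> UNIV :: ('a \<times> 'a) set" "UNIV :: 'a set"]
    by (auto simp: bij_betw_def)
  \<comment> \<open>The first component identifies \<open>U\<close> by \<open>code_inj\<close>, so
    the sets \<open>fobj P U\<close> become disjoint inside \<open>'a\<close>.\<close>
  define tag where "tag U p = pr (c (code U), p)" for U p
  have tag_inj: "U = V \<and> p = q" if "U \<in> \<F>" "V \<in> \<F>" "tag U p = tag V q" for U V p q
    using injD[OF pr that(3)[unfolded tag_def]] injD[OF c(1)] code_inj[OF that(1,2)] by auto
  define unt where "unt a = (SOME q. fst q \<in> \<F> \<and> tag (fst q) (snd q) = a)" for a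
  have unt: "unt (tag U p) = (U, p)" if U: "U \<in> \<F>" for U p
  proof -
    have "fst (unt (tag U p)) \<in> \<F> \<and> tag (fst (unt (tag U p))) (snd (unt (tag U p))) = tag U p"
      unfolding unt_def by (rule someI[of _ "(U, p)"]) (use U in auto)
    then show ?thesis using tag_inj[OF _ U] by (metis prod.collapse)
  qed
  text \<open>
    The simplicial list \<open>Z\<close> realizing \<open>P\<close> has as \<open>n\<close>-simplices the disjoint union of the \<open>P U\<close>
    with \<open>dim U = n\<close>; \<open>pt U p\<close> is the map \<open>U \<rightarrow> Z\<close> sending the generator to \<open>p\<close>.
  \<close>
  define A where "A n = {tag U p | U p. U \<in> \<F> \<and> dim U = n \<and> p \<in> fobj P U}" for n
  \<comment> \<open>Small unions are indexed by elements of \<open>'a\<close>, so the index is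
    \<open>c (code U)\<close> in place of \<open>U\<close>. Each \<open>B i\<close> is empty or an
    image of a single \<open>fobj P U\<close>.\<close>
  have smallA: "small (A n)" for n
  proof -
    define B where "B i = {tag U p | U p. U \<in> \<F> \<and> c (code U) = i \<and> p \<in> fobj P U}" for i
    have "small (B i)" if i: "i \<in> range c" for i
    proof (cases "\<exists>U\<in>\<F>. c (code U) = i")
      case True
      then obtain U where U: "U \<in> \<F>" "c (code U) = i" by blast
      have "B i \<subseteq> tag U ` fobj P U"
        using U injD[OF c(1)] code_inj by (fastforce simp: B_def)
      moreover have "small (tag U ` fobj P U)"
        using functor_obj[OF P, of U] U by (intro small_image) simp
      ultimately show ?thesis using small_subset by blast
    next
      case False
      then have "B i = {}" by (auto simp: B_def)
      then show ?thesis using small_subset[OF c(2), of "{}"] by simp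
    qed
    then have "small (\<Union>i\<in>range c. B i)" by (intro small_UN c)
    moreover have "A n \<subseteq> (\<Union>i\<in>range c. B i)" by (auto simp: A_def B_def)
    ultimately show ?thesis using small_subset by blast
  qed
  \<comment> \<open>Restriction of \<open>p\<close> along the arrow from \<open>V\<close> to
    \<open>U\<close> that sends the generator to \<open>v\<close>; \<open>res_res\<close> is
    functoriality of \<open>P\<close> combined with \<open>hat_comp\<close>.\<close>
  define res where "res U V v p = farr P U V (lift V (hat U V v)) p" for U V v p
  have P_in: "farr P U V (lift V h) p \<in> fobj P V"
    if "U \<in> \<F>" "V \<in> \<F>" "smap V U h" "p \<in> fobj P U" for U V h p
    using functor_arr[OF P, of U V "lift V h"] lift_in_Hom[OF F_slist[OF that(2)] that(3)] that by auto
  have res_in: "res U V v p \<in> fobj P V" if "U \<in> \<F>" "V \<in> \<F>" "v \<in> Ev U V" "p \<in> fobj P U" for U V v p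
    unfolding res_def using P_in that hat_smap[OF F_slist[OF that(1)] that(2,3)] by blast
  have res_gn: "res U U (gn U) p = p" if U: "U \<in> \<F>" and p: "p \<in> fobj P U" for U p
  proof -
    have "lift U (hat U U (gn U)) = Id Fop U"
      using hat_unique[OF F_slist[OF U] U smap_id refl] by (auto simp: Id_sListCat intro!: lift_cong)
    then show ?thesis using functor_id[OF P, of U] U p by (simp add: res_def)
  qed
  have res_res: "res V W w (res U V v p) = res U W (hat U V v (dim W) w) p"
    if U: "U \<in> \<F>" and V: "V \<in> \<F>" and W: "W \<in> \<F>" and v: "v \<in> Ev U V" and w: "w \<in> Ev V W" and p: "p \<in> fobj P U"
    for U V W v w p
  proof -
    note sv = hat_smap[OF F_slist[OF U] V v] and sw = hat_smap[OF F_slist[OF V] W w]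
    have "Comp Fop U V W (lift W (hat V W w)) (lift V (hat U V v))
        = lift W (hat U W (hat U V v (dim W) w))"
      using hat_comp[OF F_slist[OF U] V W v w] by (auto simp: Comp_lift[OF sw] intro!: lift_cong)
    moreover have "farr P U W (Comp Fop U V W (lift W (hat V W w)) (lift V (hat U V v)))
        = compose (fobj P U) (farr P V W (lift W (hat V W w))) (farr P U V (lift V (hat U V v)))"
      using functor_comp[OF P, of U V W] lift_in_Hom[OF F_slist[OF V] sv] lift_in_Hom[OF F_slist[OF W] sw]
        U V W by simp
    ultimately show ?thesis using p by (simp add: res_def compose_def)
  qed
  define pt where "pt U p m v = tag (cl U m v) (res U (cl U m v) v p)" for U p m v
  have pt_in: "pt U p m v \<in> A m" if "U \<in> \<F>" "p \<in> fobj P U" "v \<in> fobj U m" for U p m v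
    unfolding A_def pt_def
    using res_in[OF that(1) _ _ that(2)] cl[OF F_slist[OF that(1)] that(3)] Ev_cl[OF F_slist[OF that(1)] that(3)]
    by blast
  define r where "r n m f a = (case unt a of (U, p) \<Rightarrow> map (pt U p m) (farr U n m f (gn U)))" for n m f a
  define Z where "Z = mk_slist A r"
  have Z_tag: "farr Z n m f (tag U p) = map (pt U p m) (farr U n m f (gn U))"
    if "U \<in> \<F>" "dim U = n" "p \<in> fobj P U" "f \<in> Hom Delta m n" for U p n m f
  proof -
    have "tag U p \<in> A n" using that by (auto simp: A_def)
    then show ?thesis using that unt by (simp add: Z_def r_def)
  qed
  \<comment> \<open>The definition of \<open>r\<close> settles only generators. For a general
    \<open>v\<close>, the class \<open>V\<close> of \<open>v\<close> has \<open>v\<close> as image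
    of its generator, and \<open>res_res\<close> identifies \<open>pt\<close> on \<open>V\<close>
    with \<open>pt U p\<close> after \<open>hat U V v\<close>.\<close>
  have Z_pt: "farr Z m k f (pt U p m v) = map (pt U p k) (farr U m k f v)"
    if U: "U \<in> \<F>" and p: "p \<in> fobj P U" and v: "v \<in> fobj U m" and f: "f \<in> Hom Delta k m" for U p m k f v
  proof -
    define V where "V = cl U m v"
    note sU = F_slist[OF U]
    have V: "V \<in> \<F>" and dV: "dim V = m" and vE: "v \<in> Ev U V"
      using cl[OF sU v] Ev_cl[OF sU v] by (simp_all add: V_def)
    note sV = F_slist[OF V] and gV = gn_in[OF V, unfolded dV]
    note hs = hat_smap[OF sU V vE]
    have "farr Z m k f (pt U p m v) = map (pt V (res U V v p) k) (farr V m k f (gn V))"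
      using Z_tag[OF V dV res_in[OF U V vE p] f] by (simp add: pt_def V_def)
    moreover have "farr U m k f v = map (hat U V v k) (farr V m k f (gn V))"
      using smap_natural[OF hs f gV] hat_gn[OF sU V vE] dV by simp
    moreover have "pt V (res U V v p) k w = pt U p k (hat U V v k w)" if w: "w \<in> fobj V k" for w
      using cl_smap[OF sV hs w] res_res[OF U V cl(1)[OF sV w] vE Ev_cl[OF sV w] p] cl(3)[OF sV w]
      by (simp add: pt_def)
    ultimately show ?thesis using slist_in[OF sV f gV] by auto
  qed
  have pt_gn: "pt U p (dim U) (gn U) = tag U p" if "U \<in> \<F>" "p \<in> fobj P U" for U p
    using that by (simp add: pt_def cl_gn res_gn)
  have AE: "\<exists>U p. U \<in> \<F> \<and> dim U = n \<and> p \<in> fobj P U \<and> a = tag U p" if "a \<in> A n" for a n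
    using that by (auto simp: A_def)
  have fZ: "fobj Z = A" by (simp add: Z_def)
  have sZ: "slist Z"
    unfolding slist_def fZ
  proof (intro conjI allI ballI)
    fix m n f a assume f: "f \<in> Hom Delta m n" and "a \<in> A n"
    then obtain U p where U: "U \<in> \<F>" "dim U = n" "p \<in> fobj P U" "a = tag U p" using AE by blast
    show "set (farr Z n m f a) \<subseteq> A m"
      using Z_tag[OF U(1-3) f] pt_in[OF U(1,3)] slist_in[OF F_slist[OF U(1)] f] gn_in[OF U(1)] U by auto
  next
    fix n a assume "a \<in> A n"
    then obtain U p where U: "U \<in> \<F>" "dim U = n" "p \<in> fobj P U" "a = tag U p" using AE by blast
    show "farr Z n n (Id Delta n) a = [a]"
      using Z_tag[OF U(1-3) Delta_id] slist_id[OF F_slist[OF U(1)] gn_in[OF U(1)]] pt_gn[OF U(1,3)] U by simp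
  next
    fix k m n f g a assume f: "f \<in> Hom Delta m n" and g: "g \<in> Hom Delta k m" and "a \<in> A n"
    then obtain U p where U: "U \<in> \<F>" "dim U = n" "p \<in> fobj P U" "a = tag U p" using AE by blast
    note sU = F_slist[OF U(1)] and gU = gn_in[OF U(1), unfolded U(2)]
    have "concat (map (farr Z m k g) (map (pt U p m) vs)) = map (pt U p k) (concat (map (farr U m k g) vs))"
      if "set vs \<subseteq> fobj U m" for vs
      using that Z_pt[OF U(1,3) _ g] by (induction vs) auto
    then show "farr Z n k (Comp Delta k m n f g) a = concat (map (farr Z m k g) (farr Z n m f a))"
      using Z_tag[OF U(1-3) f] Z_tag[OF U(1-3) Delta_comp[OF f g]] slist_comp[OF sU f g gU]
        slist_in[OF sU f gU] U(4) by simp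
  qed
  have Zl: "simplicial_list small Z"
    using sZ smallA unfolding Z_def by (rule simplicial_list_mk_slist)
  have pt_smap: "smap U Z (pt U p)" if "U \<in> \<F>" "p \<in> fobj P U" for U p
    unfolding smap_def fZ using pt_in[OF that] Z_pt[OF that] by auto
  have tag_Ev: "tag U p \<in> Ev Z U" if "U \<in> \<F>" "p \<in> fobj P U" for U p
    using Ev_smap[OF F_slist[OF that(1)] pt_smap[OF that] gn_Ev[OF that(1)]] pt_gn[OF that] by simp
  \<comment> \<open>A simplex tagged by \<open>V\<close> has class \<open>V\<close> by
    \<open>tag_Ev\<close>, while membership in \<open>Ev Z U\<close> makes its class
    \<open>U\<close>.\<close>
  have Ev_tag: "\<exists>p\<in>fobj P U. x = tag U p" if U: "U \<in> \<F>" and x: "x \<in> Ev Z U" for U x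
  proof -
    obtain V p where V: "V \<in> \<F>" "dim V = dim U" "p \<in> fobj P V" "x = tag V p"
      using AE[of x "dim U"] Ev_in[OF x] fZ by auto
    then have "V = U" using cl_Ev[OF U x] cl_Ev[OF V(1) tag_Ev[OF V(1,3)]] by simp
    then show ?thesis using V by blast
  qed
  define \<theta> where "\<theta> = (\<lambda>U\<in>\<F>. \<lambda>p\<in>fobj P U. tag U p)"
  have "\<theta> \<in> nat_trans Fop (SetCat small) P (Phi Z)"
  proof -
    have "compose (fobj P V) (\<theta> U) (farr P V U \<phi>) = compose (fobj P V) (farr (Phi Z) V U \<phi>) (\<theta> V)"
      if V: "V \<in> \<F>" and U: "U \<in> \<F>" and \<phi>: "\<phi> \<in> Hom sl U V" for V U \<phi>
    proof -
      obtain h where h: "smap U V h" "\<phi> = lift U h" using Hom_F_obtain[OF U \<phi>] .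
      define v where "v = h (dim U) (gn U)"
      have v: "v \<in> Ev V U" using Ev_smap[OF F_slist[OF U] h(1) gn_Ev[OF U]] by (simp add: v_def)
      \<comment> \<open>Every arrow of \<open>\<F>\<close> is the one named by the image of the
        generator, so restriction in \<open>P\<close> along it is an instance of
        \<open>res\<close>.\<close>
      have \<phi>_hat: "lift U (hat V U v) = \<phi>"
        unfolding h using hat_unique[OF F_slist[OF V] U h(1)] by (intro lift_cong) (simp add: v_def)
      have "tag U (farr P V U \<phi> p) = hat Z V (tag V p) (dim U) v" if p: "p \<in> fobj P V" for p
        using hat_unique[OF sZ V pt_smap[OF V p] pt_gn[OF V p] Ev_in[OF v]] cl_Ev[OF U v]
        by (simp add: pt_def res_def \<phi>_hat)
      then show ?thesis
        using U V P_in[OF V U h(1)] tag_Ev[OF V] farr_Phi[OF U V h(1), of Z]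
        by (simp add: \<theta>_def compose_def fun_eq_iff restrict_def h v_def)
    qed
    then show ?thesis
      using tag_Ev by (auto simp: nat_trans_def \<theta>_def)
  qed
  moreover have "is_iso (SetCat small) (fobj P U) (fobj (Phi Z) U) (\<theta> U)" if "U \<in> Ob Fop" for U
  proof (rule is_iso_SetCat)
    have U: "U \<in> \<F>" using that by simp
    show "\<theta> U \<in> fobj P U \<rightarrow>\<^sub>E fobj (Phi Z) U" using U tag_Ev by (auto simp: \<theta>_def)
    show "bij_betw (\<theta> U) (fobj P U) (fobj (Phi Z) U)"
      using U tag_Ev[OF U] Ev_tag[OF U] tag_inj[OF U U]
      by (auto simp: bij_betw_def \<theta>_def inj_on_def)
  qed
  ultimately have "is_iso (functor_cat Fop (SetCat small)) P (Phi Z) \<theta>"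
    by (rule is_iso_functor_cat[OF category_SetCat P is_functor_Phi[OF Zl]])
  then have "isomorphic (functor_cat Fop (SetCat small)) P (Phi Z)"
    unfolding isomorphic_def by blast
  then have "isomorphic (functor_cat Fop (SetCat small)) (Phi Z) P"
    by (rule isomorphic_sym)
  then show ?thesis
    using Zl by (intro bexI[of _ Z]) (simp_all add: PhiF_def)
qed

lemma equivalence: "equivalent_categories sl (functor_cat Fop (SetCat small))"
  by (rule equivalence_of_fully_faithful[OF category_sListCat category_functor_cat[OF category_SetCat]
        is_functor_PhiF PhiF_fully_faithful])
    (use PhiF_essentially_surjective in auto)

end

text \<open>The first conjunct keeps the second from being vacuous; the second shows that the
  equivalence is independent of the choice of representatives.\<close>

theorem theorem1p3:
  fixes small :: "'a set \<Rightarrow> bool"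
  assumes "set_universe small"
  shows "(\<exists>\<F>. skeleton_of (sListCat small) (fundamental_objects small) \<F>) \<and>
    (\<forall>\<F>. skeleton_of (sListCat small) (fundamental_objects small) \<F> \<longrightarrow>
       equivalent_categories (sListCat small)
         (functor_cat (op_cat (full_subcat (sListCat small) \<F>)) (SetCat small)))"
proof (intro conjI allI impI)
  show "\<exists>\<F>. skeleton_of (sListCat small) (fundamental_objects small) \<F>"
    by (rule skeleton_exists[OF category_sListCat]) (auto simp: fundamental_objects_def)
  fix \<F> assume "skeleton_of (sListCat small) (fundamental_objects small) \<F>"
  then interpret slist_skeleton small \<F>
    using assms by unfold_locales
  show "equivalent_categories (sListCat small)
      (functor_cat (op_cat (full_subcat (sListCat small) \<F>)) (SetCat small))"
    by (rule equivalence)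
qed

end
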